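(* For every prime $p$, every even positive integer $n$ and every positive integer $m\le n/2$, there exist an almost balanced bent function $F\colon\mathbb{F}_p^n\to\mathbb{F}_p^m$ of type $(+)$ and an almost balanced bent function $F\colon\mathbb{F}_p^n\to\mathbb{F}_p^m$ of type $(-)$.
   Context: A function $F\colon\mathbb{F}_p^n\to\mathbb{F}_p^m$ is bent (perfect nonlinear) if $|\{x: F(x+a)-F(x)=b\}|=p^{n-m}$ for all nonzero $a\in\mathbb{F}_p^n$ and all $b\in\mathbb{F}_p^m$. A bent function $F\colon\mathbb{F}_p^n\to\mathbb{F}_p^m$ is almost balanced of type $(+)$ if for some $\alpha\in\mathbb{F}_p^m$, $|F^{-1}(\alpha)|=p^{n-m}+p^{n/2}-p^{n/2-m}$ and $|F^{-1}(\beta)|=p^{n-m}-p^{n/2-m}$ for all $\beta\neq\alpha$; it is almost balanced of type $(-)$ if for some $\alpha$, $|F^{-1}(\alpha)|=p^{n-m}-p^{n/2}+p^{n/2-m}$ and $|F^{-1}(\beta)|=p^{n-m}+p^{n/2-m}$ for all $\beta\neq\alpha$. *)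

theory Defs
  imports Complex_Main "HOL-Library.FuncSet" "HOL-Number_Theory.Residues"
begin

text \<open>The field \<open>F_p\<close> is \<^term>\<open>residue_ring (int p)\<close>, with carrier \<open>{0..int p - 1}\<close>. Vectors
  of length \<open>n\<close> are extensional functions on \<open>{..<n}\<close>, so that equality of vectors is equality
  of functions and cardinalities of sets of vectors are the intended ones.\<close>

definition Fp_space :: "nat \<Rightarrow> nat \<Rightarrow> (nat \<Rightarrow> int) set" where
  "Fp_space p n = {..<n} \<rightarrow>\<^sub>E carrier (residue_ring (int p))"

definition Fp_zero :: "nat \<Rightarrow> nat \<Rightarrow> nat \<Rightarrow> int" where
  "Fp_zero p n = (\<lambda>i\<in>{..<n}. \<zero>\<^bsub>residue_ring (int p)\<^esub>)"

definition Fp_add :: "nat \<Rightarrow> nat \<Rightarrow> (nat \<Rightarrow> int) \<Rightarrow> (nat \<Rightarrow> int) \<Rightarrow> nat \<Rightarrow> int" where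
  "Fp_add p n x y = (\<lambda>i\<in>{..<n}. x i \<oplus>\<^bsub>residue_ring (int p)\<^esub> y i)"

definition Fp_diff :: "nat \<Rightarrow> nat \<Rightarrow> (nat \<Rightarrow> int) \<Rightarrow> (nat \<Rightarrow> int) \<Rightarrow> nat \<Rightarrow> int" where
  "Fp_diff p n x y = (\<lambda>i\<in>{..<n}. x i \<ominus>\<^bsub>residue_ring (int p)\<^esub> y i)"

definition fibre :: "nat \<Rightarrow> nat \<Rightarrow> ((nat \<Rightarrow> int) \<Rightarrow> nat \<Rightarrow> int) \<Rightarrow> (nat \<Rightarrow> int) \<Rightarrow> (nat \<Rightarrow> int) set" where
  "fibre p n F \<beta> = {x \<in> Fp_space p n. F x = \<beta>}"

text \<open>Exponents such as \<open>n - m\<close> and \<open>n/2 - m\<close> are real, which avoids truncated subtraction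
  and division, so the definitions are meaningful for all \<open>n\<close> and \<open>m\<close>.\<close>

definition bent :: "nat \<Rightarrow> nat \<Rightarrow> nat \<Rightarrow> ((nat \<Rightarrow> int) \<Rightarrow> nat \<Rightarrow> int) \<Rightarrow> bool" where
  "bent p n m F \<longleftrightarrow>
     F \<in> Fp_space p n \<rightarrow> Fp_space p m \<and>
     (\<forall>a \<in> Fp_space p n - {Fp_zero p n}. \<forall>b \<in> Fp_space p m.
        real (card {x \<in> Fp_space p n. Fp_diff p m (F (Fp_add p n x a)) (F x) = b})
          = real p powr (real n - real m))"

definition almost_balanced_plus :: "nat \<Rightarrow> nat \<Rightarrow> nat \<Rightarrow> ((nat \<Rightarrow> int) \<Rightarrow> nat \<Rightarrow> int) \<Rightarrow> bool" where
  "almost_balanced_plus p n m F \<longleftrightarrow>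
     (\<exists>\<alpha> \<in> Fp_space p m.
        real (card (fibre p n F \<alpha>))
          = real p powr (real n - real m) + real p powr (real n / 2)
            - real p powr (real n / 2 - real m) \<and>
        (\<forall>\<beta> \<in> Fp_space p m - {\<alpha>}.
           real (card (fibre p n F \<beta>))
             = real p powr (real n - real m) - real p powr (real n / 2 - real m)))"

definition almost_balanced_minus :: "nat \<Rightarrow> nat \<Rightarrow> nat \<Rightarrow> ((nat \<Rightarrow> int) \<Rightarrow> nat \<Rightarrow> int) \<Rightarrow> bool" where
  "almost_balanced_minus p n m F \<longleftrightarrow>
     (\<exists>\<alpha> \<in> Fp_space p m.
        real (card (fibre p n F \<alpha>))
          = real p powr (real n - real m) - real p powr (real n / 2)
            + real p powr (real n / 2 - real m) \<and>
        (\<forall>\<beta> \<in> Fp_space p m - {\<alpha>}.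
           real (card (fibre p n F \<beta>))
             = real p powr (real n - real m) + real p powr (real n / 2 - real m)))"

end

theory Submission
  imports Defs "HOL-Algebra.Algebraic_Closure"
begin

hide_const (open) Divisibility.prime

text \<open>Let \<open>q = p ^ k\<close> with \<open>n = 2 k\<close>. For type \<open>(+)\<close> take the multiplication
  \<open>F_q \<times> F_q \<rightarrow> F_q\<close>, for type \<open>(-)\<close> the norm \<open>x ^ (q + 1)\<close> from \<open>F_(q\<^sup>2)\<close> to
  \<open>F_q\<close>. Their derivatives in nonzero directions are affine and onto \<open>F_q\<close>, with fibres of size \<open>q\<close>, and
  their fibres have sizes \<open>2 q - 1\<close> and \<open>1\<close> over zero, \<open>q - 1\<close> and \<open>q + 1\<close> elsewhere.
  Composing with a linear map of \<open>F_q\<close> onto \<open>F_p ^ m\<close> gives the theorem. Only the additive groups of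
  these fields matter at that point, and they are identified with \<open>F_p ^ k\<close> and \<open>F_p ^ n\<close> as
  elementary abelian groups.\<close>

section \<open>Existence of finite fields\<close>

text \<open>The two maps are the two nondegenerate quadratic forms on a plane over F_q:
  multiplication is the hyperbolic one, whose zeros are the two axes, and the norm is the
  anisotropic one, whose only zero is the origin. The two signs come from this difference. The
  derivative of a quadratic form is its polar form plus a constant, and here the polar form is
  nondegenerate in every characteristic, including 2, so no case distinction on \<open>p\<close>
  arises. The condition \<open>m \<le> k\<close> is what a surjection from F_q to F_p^m requires. Of
  the \<open>p ^ (k - m)\<close> elements of F_q above a vector, all are nonzero unless the vector
  is zero, in which case exactly one is zero; thus only the zero fibre of the composite is
  exceptional. Neither the norm nor the trace is shown to be onto directly. Root counting bounds
  every fibre from above, and the total number of elements then forces equality.\<close>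

lemma (in cring) binomial_finsum:
  assumes [simp]: "x \<in> carrier R" "y \<in> carrier R"
  shows "(x \<oplus> y) [^] n = (\<Oplus>i\<in>{..n}. [(n choose i)] \<cdot> (x [^] i \<otimes> y [^] (n - i)))"
proof (induction n)
  case 0
  show ?case by simp
next
  case (Suc n)
  define t where "t = (\<lambda>i j. x [^] (i::nat) \<otimes> y [^] (j::nat))"
  have [simp]: "t i j \<in> carrier R" for i j
    by (simp add: t_def)
  have tx: "t i j \<otimes> x = t (Suc i) j" for i j
    by (simp add: t_def) (metis assms m_comm m_assoc nat_pow_closed)
  have ty: "t i j \<otimes> y = t i (Suc j)" for i j
    by (simp add: t_def m_assoc)
  let ?b = "\<lambda>i. [(n choose i)] \<cdot> t (Suc i) (n - i)"
  let ?c = "\<lambda>i. [(n choose i)] \<cdot> t i (Suc n - i)"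
  have "(x \<oplus> y) [^] Suc n = (\<Oplus>i\<in>{..n}. [(n choose i)] \<cdot> t i (n - i)) \<otimes> (x \<oplus> y)"
    using Suc by (simp add: t_def)
  also have "\<dots> = (\<Oplus>i\<in>{..n}. [(n choose i)] \<cdot> t i (n - i) \<otimes> (x \<oplus> y))"
    by (intro finsum_ldistr) auto
  also have "\<dots> = (\<Oplus>i\<in>{..n}. ?b i \<oplus> ?c i)"
    by (intro finsum_cong') (auto simp: r_distr add_pow_ldistr tx ty Suc_diff_le)
  also have "\<dots> = (\<Oplus>i\<in>{..n}. ?b i) \<oplus> (\<Oplus>i\<in>{..n}. ?c i)"
    by (intro finsum_addf) auto
  \<comment> \<open>The extra top term vanishes, since \<open>n choose Suc n\<close> is 0. With it,
    splitting off index 0 leaves two sums over the same monomials, and Pascal's rule merges their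
    coefficients.\<close>
  also have "(\<Oplus>i\<in>{..n}. ?c i) = (\<Oplus>i\<in>{..Suc n}. ?c i)"
    by (subst finsum_Suc) (auto simp: binomial_eq_0)
  also have "\<dots> = (\<Oplus>i\<in>{..n}. [(n choose Suc i)] \<cdot> t (Suc i) (n - i)) \<oplus> t 0 (Suc n)"
    by (subst finsum_Suc2) auto
  also have "(\<Oplus>i\<in>{..n}. ?b i) \<oplus> ((\<Oplus>i\<in>{..n}. [(n choose Suc i)] \<cdot> t (Suc i) (n - i)) \<oplus> t 0 (Suc n))
      = ((\<Oplus>i\<in>{..n}. ?b i) \<oplus> (\<Oplus>i\<in>{..n}. [(n choose Suc i)] \<cdot> t (Suc i) (n - i))) \<oplus> t 0 (Suc n)"
    by (subst a_assoc) (auto intro!: finsum_closed)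
  also have "(\<Oplus>i\<in>{..n}. ?b i) \<oplus> (\<Oplus>i\<in>{..n}. [(n choose Suc i)] \<cdot> t (Suc i) (n - i))
      = (\<Oplus>i\<in>{..n}. ?b i \<oplus> [(n choose Suc i)] \<cdot> t (Suc i) (n - i))"
    by (intro finsum_addf[symmetric]) auto
  also have "\<dots> = (\<Oplus>i\<in>{..n}. [(Suc n choose Suc i)] \<cdot> t (Suc i) (Suc n - Suc i))"
    by (intro finsum_cong') (auto simp: add.nat_pow_mult)
  also have "\<dots> \<oplus> t 0 (Suc n) = (\<Oplus>i\<in>{..Suc n}. [(Suc n choose i)] \<cdot> t i (Suc n - i))"
    by (subst finsum_Suc2) auto
  finally show ?case
    by (simp only: t_def)
qed

text \<open>All binomial coefficients strictly between the ends are divisible by \<open>p\<close>,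
  so only the two end terms of the expansion survive. The characteristic enters as an equation for
  each element, a form that also suits the polynomial ring below.\<close>

lemma (in cring) frobenius_add:
  assumes p: "prime (p::nat)" and char: "\<And>z. z \<in> carrier R \<Longrightarrow> [p] \<cdot> z = \<zero>"
    and [simp]: "x \<in> carrier R" "y \<in> carrier R"
  shows "(x \<oplus> y) [^] p = x [^] p \<oplus> y [^] p"
proof -
  let ?f = "\<lambda>i. [(p choose i)] \<cdot> (x [^] i \<otimes> y [^] (p - i))"
  have zero: "?f i = \<zero>" if i: "i \<noteq> 0" "i < p" for i
  proof -
    have "p dvd p choose i"
      using dvd_choose_prime[of i p] i p by simp
    then obtain c where c: "p choose i = p * c" ..
    show ?thesis
      unfolding c by (subst add.nat_pow_pow[symmetric]) (auto simp: char)
  qed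
  obtain q where q: "p = Suc q"
    using prime_gt_0_nat[OF p] by (metis gr0_implies_Suc)
  have "(x \<oplus> y) [^] p = finsum R ?f {..Suc q}"
    using binomial_finsum[of x y p] by (simp add: q)
  also have "\<dots> = ?f p \<oplus> finsum R ?f {..q}"
    by (subst finsum_Suc) (auto simp: q)
  also have "finsum R ?f {..q} = finsum R ?f {0}"
    by (intro add.finprod_mono_neutral_cong_right) (auto simp: zero[unfolded q] q)
  also have "\<dots> = y [^] p"
    by (simp add: finsum_insert)
  finally show ?thesis by simp
qed

lemma (in cring) frobenius_power_add:
  assumes p: "prime (p::nat)" and char: "\<And>z. z \<in> carrier R \<Longrightarrow> [p] \<cdot> z = \<zero>"
    and [simp]: "x \<in> carrier R" "y \<in> carrier R"
  shows "(x \<oplus> y) [^] (p ^ k) = x [^] (p ^ k) \<oplus> y [^] (p ^ k)"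
proof (induction k)
  case 0
  show ?case by simp
next
  case (Suc k)
  have "(x \<oplus> y) [^] (p ^ Suc k) = ((x \<oplus> y) [^] (p ^ k)) [^] p"
    by (simp add: nat_pow_pow mult.commute)
  also have "\<dots> = (x [^] (p ^ k)) [^] p \<oplus> (y [^] (p ^ k)) [^] p"
    unfolding Suc by (intro frobenius_add[OF p char]) auto
  finally show ?case
    by (simp add: nat_pow_pow mult.commute)
qed

text \<open>Applying additivity to the sum of \<open>x\<close> and its negative avoids evaluating a
  power of -1, so even and odd \<open>p\<close> need no separate treatment.\<close>

lemma (in cring) frobenius_power_minus:
  assumes p: "prime (p::nat)" and char: "\<And>z. z \<in> carrier R \<Longrightarrow> [p] \<cdot> z = \<zero>"
    and [simp]: "x \<in> carrier R"
  shows "(\<ominus> x) [^] (p ^ k) = \<ominus> (x [^] (p ^ k))"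
proof -
  have "x [^] (p ^ k) \<oplus> (\<ominus> x) [^] (p ^ k) = (x \<oplus> \<ominus> x) [^] (p ^ k)"
    by (intro frobenius_power_add[OF p char, symmetric]) auto
  also have "\<dots> = \<zero>"
    using prime_gt_0_nat[OF p] by (simp add: r_neg nat_pow_zero)
  finally show ?thesis
    by (metis a_comm assms(3) a_inv_closed minus_equality nat_pow_closed)
qed

section \<open>Fixed points of powers of Frobenius\<close>

lemma (in domain) frobenius_fixed_subring:
  assumes p: "prime (p::nat)" and char: "\<And>z. z \<in> carrier R \<Longrightarrow> [p] \<cdot> z = \<zero>"
  shows "subring {x \<in> carrier R. x [^] (p ^ k) = x} R"
  using frobenius_power_add[OF p char] frobenius_power_minus[OF p char]
  by (intro subringI) (auto simp: nat_pow_distrib)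

lemma (in field) frobenius_fixed_subfield:
  assumes p: "prime (p::nat)" and char: "\<And>z. z \<in> carrier R \<Longrightarrow> [p] \<cdot> z = \<zero>"
  shows "subfield {x \<in> carrier R. x [^] (p ^ k) = x} R"
proof (rule subfieldI')
  fix x assume x: "x \<in> {x \<in> carrier R. x [^] (p ^ k) = x} - {\<zero>}"
  then have u: "x \<in> Units R"
    by (simp add: field_Units)
  then have i: "inv x \<in> carrier R" by simp
  have "inv x [^] (p ^ k) \<otimes> x [^] (p ^ k) = \<one>"
    using u i Units_closed[OF u] by (simp flip: nat_pow_distrib)
  then have "inv x [^] (p ^ k) = inv x"
    using x i by (intro comm_inv_char[symmetric]) (auto simp: m_comm)
  then show "inv x \<in> {x \<in> carrier R. x [^] (p ^ k) = x}"
    using i by simp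
qed (rule frobenius_fixed_subring[OF p char])

text \<open>A homomorphism preserves multiples of one, and the multiple of \<open>z\<close> is the
  same multiple of one times \<open>z\<close>. This carries the characteristic from the prime field
  to its closure, and from a field to its polynomial ring.\<close>

lemma (in ring_hom_ring) hom_char:
  assumes "[p] \<cdot> \<one> = \<zero>" and z: "z \<in> carrier S"
  shows "[(p::nat)] \<cdot>\<^bsub>S\<^esub> z = \<zero>\<^bsub>S\<^esub>"
proof -
  have "h ([n] \<cdot> \<one>) = [n] \<cdot>\<^bsub>S\<^esub> \<one>\<^bsub>S\<^esub>" for n :: nat
    by (induction n) auto
  then have "[p] \<cdot>\<^bsub>S\<^esub> \<one>\<^bsub>S\<^esub> = \<zero>\<^bsub>S\<^esub>"
    using assms(1) by (metis hom_zero)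
  then show ?thesis
    using S.add_pow_ldistr[of "\<one>\<^bsub>S\<^esub>" z p] z by simp
qed

text \<open>\<open>X ^ (p ^ k) - X\<close> has no repeated root: at a root \<open>a\<close> it equals
  \<open>(X - a) ^ (p ^ k) - (X - a)\<close>.\<close>

lemma (in algebraically_closed) card_frobenius_fixed:
  assumes p: "prime (p::nat)" and char: "\<And>z. z \<in> carrier L \<Longrightarrow> [p] \<cdot> z = \<zero>" and k: "k > 0"
  shows "card {x \<in> carrier L. x [^] (p ^ k) = x} = p ^ k"
proof -
  define Q where "Q = p ^ k"
  have Q: "Q > 1"
    unfolding Q_def using prime_gt_1_nat[OF p] k by (rule one_less_power)
  define UP where "UP = poly_ring L"
  interpret UP: domain UP
    unfolding UP_def by (rule univ_poly_is_domain[OF carrier_is_subring])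
  interpret C: ring_hom_ring L UP poly_of_const
    using canonical_embedding_ring_hom[OF carrier_is_subring] by (simp add: UP_def)
  have charP: "[p] \<cdot>\<^bsub>UP\<^esub> f = \<zero>\<^bsub>UP\<^esub>" if "f \<in> carrier UP" for f
    by (rule C.hom_char) (simp_all add: char that)
  have X: "X \<in> carrier UP"
    using var_closed[OF carrier_is_subring] by (simp add: UP_def)
  define P where "P = X [^]\<^bsub>UP\<^esub> Q \<ominus>\<^bsub>UP\<^esub> X"
  have P: "P \<in> carrier UP"
    using X by (simp add: P_def)
  have deg: "degree P = Q"
  proof -
    have 1: "degree (X [^]\<^bsub>UP\<^esub> Q) = Q"
      using polynomial_pow_degree[of X Q] X by (simp add: UP_def var_def)
    have 2: "degree (\<ominus>\<^bsub>UP\<^esub> X) = 1"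
      using univ_poly_a_inv_degree[OF carrier_is_subring] X by (simp add: UP_def var_def)
    have "degree P = max Q 1"
      using poly_add_degree_eq[OF carrier_is_subring, of "X [^]\<^bsub>UP\<^esub> Q" "\<ominus>\<^bsub>UP\<^esub> X"] 1 2 Q X
        UP.nat_pow_closed[OF X, of Q] UP.a_inv_closed[OF X]
      by (simp add: P_def a_minus_def UP_def univ_poly_carrier univ_poly_add)
    then show ?thesis using Q by simp
  qed
  then have P0: "P \<noteq> []"
    using Q by auto
  have evalP: "eval P x = x [^] Q \<ominus> x" if x: "x \<in> carrier L" for x
  proof -
    interpret E: ring_hom_ring UP L "\<lambda>p. eval p x"
      unfolding UP_def by (rule eval_ring_hom[OF carrier_is_subring x])
    show ?thesis
      using X x E.hom_nat_pow[OF X, of Q] by (simp add: P_def a_minus_def eval_var)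
  qed
  have mult: "alg_mult P a \<le> 1" for a
  proof (rule ccontr)
    assume neg: "\<not> alg_mult P a \<le> 1"
    \<comment> \<open>Outside the carrier \<open>alg_mult\<close> is 0 by definition.\<close>
    then have a: "a \<in> carrier L"
      by (auto simp: alg_mult_def split: if_splits)
    have "is_root P a"
      using neg P alg_mult_gt_zero_iff_is_root[of P a] by (simp add: UP_def)
    then have fixed: "a [^] Q = a"
      using evalP[OF a] a by (simp add: is_root_def)
    define D where "D = [\<one>, \<ominus> a]"
    have D: "D \<in> carrier UP"
      using a by (simp add: D_def UP_def polynomial_def flip: univ_poly_carrier)
    have D0: "D \<noteq> \<zero>\<^bsub>UP\<^esub>"
      by (simp add: D_def UP_def univ_poly_zero)
    have X_eq: "X = D \<oplus>\<^bsub>UP\<^esub> poly_of_const a"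
      using a by (auto simp: D_def UP_def univ_poly_add var_def poly_of_const_def l_neg)
    have "X [^]\<^bsub>UP\<^esub> Q = D [^]\<^bsub>UP\<^esub> Q \<oplus>\<^bsub>UP\<^esub> poly_of_const a [^]\<^bsub>UP\<^esub> Q"
      unfolding X_eq Q_def using a D by (intro UP.frobenius_power_add[OF p charP]) auto
    also have "poly_of_const a [^]\<^bsub>UP\<^esub> Q = poly_of_const a"
      using fixed C.hom_nat_pow[OF a, of Q] by simp
    finally have "P = D [^]\<^bsub>UP\<^esub> Q \<oplus>\<^bsub>UP\<^esub> poly_of_const a \<ominus>\<^bsub>UP\<^esub> (D \<oplus>\<^bsub>UP\<^esub> poly_of_const a)"
      by (simp add: P_def flip: X_eq)
    also have "\<dots> = D [^]\<^bsub>UP\<^esub> Q \<ominus>\<^bsub>UP\<^esub> D"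
    proof -
      have "u \<oplus>\<^bsub>UP\<^esub> c \<ominus>\<^bsub>UP\<^esub> (d \<oplus>\<^bsub>UP\<^esub> c) = u \<ominus>\<^bsub>UP\<^esub> d"
        if "u \<in> carrier UP" "c \<in> carrier UP" "d \<in> carrier UP" for u c d
        using that by algebra
      then show ?thesis using a D by simp
    qed
    also have "\<dots> = D \<otimes>\<^bsub>UP\<^esub> (D [^]\<^bsub>UP\<^esub> (Q - 1) \<ominus>\<^bsub>UP\<^esub> \<one>\<^bsub>UP\<^esub>)"
    proof -
      have "D [^]\<^bsub>UP\<^esub> Q = D \<otimes>\<^bsub>UP\<^esub> D [^]\<^bsub>UP\<^esub> (Q - 1)"
        using Q D UP.nat_pow_Suc2[of D "Q - 1"] by simp
      then show ?thesis
        using D by (simp add: a_minus_def UP.r_distr UP.r_minus)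
    qed
    finally have P_eq: "P = D \<otimes>\<^bsub>UP\<^esub> (D [^]\<^bsub>UP\<^esub> (Q - 1) \<ominus>\<^bsub>UP\<^esub> \<one>\<^bsub>UP\<^esub>)" .
    have "D [^]\<^bsub>UP\<^esub> (2::nat) divides\<^bsub>UP\<^esub> P"
      using le_alg_mult_imp_pdivides[of a P 2] a P neg by (simp add: UP_def D_def pdivides_def)
    then obtain S where S: "S \<in> carrier UP" "P = D [^]\<^bsub>UP\<^esub> (2::nat) \<otimes>\<^bsub>UP\<^esub> S"
      by (auto simp: factor_def)
    then have "P = D \<otimes>\<^bsub>UP\<^esub> (D \<otimes>\<^bsub>UP\<^esub> S)"
      using D by (simp add: numeral_2_eq_2 UP.m_assoc)
    \<comment> \<open>Polynomials form a domain, so one factor \<open>D\<close> cancels. Evaluated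
      at the root \<open>a\<close> of \<open>D\<close>, the left side is 0 and the right side is -1;
      here \<open>Q > 1\<close> makes the power of 0 vanish.\<close>
    then have cancel: "D \<otimes>\<^bsub>UP\<^esub> S = D [^]\<^bsub>UP\<^esub> (Q - 1) \<ominus>\<^bsub>UP\<^esub> \<one>\<^bsub>UP\<^esub>"
      using D0 D S P_eq by (metis UP.m_lcancel UP.m_closed UP.minus_closed UP.nat_pow_closed UP.one_closed)
    interpret E: ring_hom_ring UP L "\<lambda>p. eval p a"
      unfolding UP_def by (rule eval_ring_hom[OF carrier_is_subring a])
    have "eval D a = \<zero>"
      using a by (simp add: D_def r_neg)
    then have "\<zero> = \<zero> [^] (Q - 1) \<ominus> \<one>"
      using arg_cong[OF cancel, of "\<lambda>p. eval p a"] D S E.hom_nat_pow[OF D, of "Q - 1"]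
      by (simp add: a_minus_def)
    also have "\<dots> = \<ominus> \<one>"
      using Q by (simp add: nat_pow_zero a_minus_def)
    finally show False
      using one_not_zero by (metis minus_minus minus_zero one_closed)
  qed
  have count: "count (roots P) a \<le> 1" for a
    using mult[of a] alg_mult_eq_count_roots[of P] P by (simp add: UP_def)
  \<comment> \<open>Over an algebraically closed field the degree counts the roots with
    multiplicity. As all multiplicities are at most 1, the multiset of roots may be counted as a
    set.\<close>
  have "Q = size (roots P)"
    using roots_over_carrier[of P] P deg by (simp add: UP_def splitted_def)
  also have "roots P = mset_set (set_mset (roots P))"
  proof (rule multiset_eqI)
    fix a show "count (roots P) a = count (mset_set (set_mset (roots P))) a"
      using count[of a] count_greater_zero_iff[of "roots P" a]
      by (cases "a \<in># roots P") (auto simp: not_in_iff simp del: count_greater_zero_iff)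
  qed
  also have "size \<dots> = card (set_mset (roots P))"
    by simp
  also have "set_mset (roots P) = {x \<in> carrier L. x [^] Q = x}"
    using roots_mem_iff_is_root[of P] P P0 evalP by (auto simp: UP_def is_root_def)
  finally show ?thesis
    by (simp add: Q_def)
qed

text \<open>The field consists of the elements fixed by the \<open>k\<close>-th power of Frobenius
  in an algebraic closure of the integers modulo \<open>p\<close>. The unusual element type is that
  of the closure constructed over a field of integers; naming it makes the existential statement
  possible.\<close>

theorem exists_finite_field:
  assumes p: "prime (p::nat)" and k: "k > 0"
  shows "\<exists>L :: ((int list \<times> nat) multiset \<Rightarrow> int) ring.
           field L \<and> card (carrier L) = p ^ k \<and> (\<forall>z\<in>carrier L. [p] \<cdot>\<^bsub>L\<^esub> z = \<zero>\<^bsub>L\<^esub>)"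
proof -
  define R where "R = residue_ring (int p)"
  interpret R: residues_prime p R
    using p by unfold_locales (auto simp: R_def)
  obtain \<Omega> :: "((int list \<times> nat) multiset \<Rightarrow> int) ring" where
    \<Omega>: "algebraic_closure \<Omega> (R.indexed_const ` carrier R)"
    and hom: "R.indexed_const \<in> ring_hom R \<Omega>"
    using R.exists_closure by blast
  interpret \<Omega>: algebraic_closure \<Omega> "R.indexed_const ` carrier R"
    by (rule \<Omega>)
  interpret h: ring_hom_ring R \<Omega> R.indexed_const
    by (intro ring_hom_ringI2 hom R.ring_axioms \<Omega>.ring_axioms)
  have "[n] \<cdot>\<^bsub>R\<^esub> \<one>\<^bsub>R\<^esub> = int n mod int p" for n
    by (induction n) (auto simp: R.res_add_eq R.res_one_eq R.res_zero_eq mod_simps ac_simps)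
  then have "[p] \<cdot>\<^bsub>R\<^esub> \<one>\<^bsub>R\<^esub> = \<zero>\<^bsub>R\<^esub>"
    by (simp add: R.res_zero_eq)
  then have char: "[p] \<cdot>\<^bsub>\<Omega>\<^esub> z = \<zero>\<^bsub>\<Omega>\<^esub>" if "z \<in> carrier \<Omega>" for z
    using that by (rule h.hom_char)
  define K where "K = {x \<in> carrier \<Omega>. x [^]\<^bsub>\<Omega>\<^esub> (p ^ k) = x}"
  let ?L = "\<Omega>\<lparr>carrier := K\<rparr>"
  have "field ?L"
    using \<Omega>.frobenius_fixed_subfield[OF p char] by (simp add: K_def \<Omega>.subfield_iff(2))
  moreover have "card (carrier ?L) = p ^ k"
    using \<Omega>.card_frobenius_fixed[OF p char k] by (simp add: K_def)
  moreover have "[p] \<cdot>\<^bsub>?L\<^esub> z = \<zero>\<^bsub>?L\<^esub>" if "z \<in> carrier ?L" for z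
  proof -
    \<comment> \<open>Shrinking the carrier leaves the operations alone, and multiples depend only
      on these.\<close>
    have "[n] \<cdot>\<^bsub>?L\<^esub> z = [n] \<cdot>\<^bsub>\<Omega>\<^esub> z" for n :: nat
      by (simp add: add_pow_def nat_pow_def)
    then show ?thesis
      using char[of z] that by (simp add: K_def)
  qed
  ultimately show ?thesis by blast
qed

section \<open>Elementary abelian groups as vector spaces\<close>

text \<open>A linear combination, in multiplicative notation. The coefficients are arbitrary
  integers and not residues, so that the laws for sums and multiples hold without any reduction; the
  prime enters only when coefficients are compared modulo \<open>p\<close>.\<close>

definition (in comm_group) power_comb :: "nat \<Rightarrow> (nat \<Rightarrow> 'a) \<Rightarrow> (nat \<Rightarrow> int) \<Rightarrow> 'a" where
  "power_comb n g x = (\<Otimes>i\<in>{..<n}. g i [^] x i)"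

definition (in comm_group) independent_mod :: "nat \<Rightarrow> nat \<Rightarrow> (nat \<Rightarrow> 'a) \<Rightarrow> bool" where
  "independent_mod p n g \<longleftrightarrow>
     g \<in> {..<n} \<rightarrow> carrier G \<and> (\<forall>x. power_comb n g x = \<one> \<longrightarrow> (\<forall>i<n. int p dvd x i))"

context comm_group
begin

lemma power_comb_closed [simp]:
  "g \<in> {..<n} \<rightarrow> carrier G \<Longrightarrow> power_comb n g x \<in> carrier G"
  by (auto simp: power_comb_def intro!: finprod_closed)

lemma power_comb_0 [simp]: "power_comb 0 g x = \<one>"
  by (simp add: power_comb_def)

lemma power_comb_Suc:
  "g \<in> {..<Suc n} \<rightarrow> carrier G \<Longrightarrow> power_comb (Suc n) g x = g n [^] x n \<otimes> power_comb n g x"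
  unfolding power_comb_def lessThan_Suc by (intro finprod_insert) auto

lemma power_comb_add:
  "g \<in> {..<n} \<rightarrow> carrier G \<Longrightarrow>
    power_comb n g (\<lambda>i. x i + y i) = power_comb n g x \<otimes> power_comb n g y"
proof (induction n)
  case (Suc n)
  then have "g \<in> {..<n} \<rightarrow> carrier G" "g n \<in> carrier G" by auto
  then show ?case
    using Suc by (simp add: power_comb_Suc int_pow_mult m_ac)
qed simp

lemma power_comb_scale:
  "g \<in> {..<n} \<rightarrow> carrier G \<Longrightarrow> power_comb n g (\<lambda>i. x i * c) = power_comb n g x [^] c"
proof (induction n)
  case (Suc n)
  then have "g \<in> {..<n} \<rightarrow> carrier G" "g n \<in> carrier G" by auto
  then show ?case
    using Suc by (simp add: power_comb_Suc int_pow_distrib int_pow_pow)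
qed simp

lemma power_comb_diff:
  "g \<in> {..<n} \<rightarrow> carrier G \<Longrightarrow>
    power_comb n g (\<lambda>i. x i - y i) = power_comb n g x \<otimes> inv power_comb n g y"
  using power_comb_add[of g n x "\<lambda>i. y i * -1"] power_comb_scale[of g n y "-1"]
  by (simp add: int_pow_neg)

lemma power_comb_cong:
  assumes "\<And>z. z \<in> carrier G \<Longrightarrow> z [^] p = \<one>" and g: "g \<in> {..<n} \<rightarrow> carrier G"
    and "\<And>i. i < n \<Longrightarrow> x i mod int p = y i mod int p"
  shows "power_comb n g x = power_comb n g y"
proof -
  have "z [^] a = z [^] b" if z: "z \<in> carrier G" and ab: "a mod int p = b mod int p" for z and a b :: int
  proof -
    obtain c where "b - a = int p * c"
      using ab by (metis mod_eq_dvd_iff dvdE)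
    then have "b = a + int p * c" by simp
    then have "z [^] b = z [^] a \<otimes> (z [^] int p) [^] c"
      using z by (simp add: int_pow_mult int_pow_pow)
    then show ?thesis
      using assms(1)[OF z] z by (simp add: int_pow_int)
  qed
  then have "g i [^] x i = g i [^] y i" if "i < n" for i
    using that g assms(3) by (meson PiE lessThan_iff)
  then show ?thesis
    unfolding power_comb_def using g by (intro finprod_cong') auto
qed

text \<open>If the coefficient of \<open>v\<close> in a relation were prime to \<open>p\<close>, an
  inverse modulo \<open>p\<close> would express \<open>v\<close> through the old family. Hence
  \<open>p\<close> divides it, the power of \<open>v\<close> is trivial, and a relation among the
  old elements remains.\<close>

lemma independent_mod_extend:
  assumes p: "prime p" and exponent: "\<And>z. z \<in> carrier G \<Longrightarrow> z [^] p = \<one>"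
    and indep: "independent_mod p n g" and v: "v \<in> carrier G" "v \<notin> range (power_comb n g)"
  shows "independent_mod p (Suc n) (g(n := v))"
proof -
  let ?g = "g(n := v)"
  have g: "g \<in> {..<n} \<rightarrow> carrier G"
    using indep by (simp add: independent_mod_def)
  have g': "?g \<in> {..<Suc n} \<rightarrow> carrier G"
    using g v by (auto simp: less_Suc_eq)
  have "\<forall>i<Suc n. int p dvd x i" if "power_comb (Suc n) ?g x = \<one>" for x
  proof -
    have "power_comb n ?g x = power_comb n g x"
      unfolding power_comb_def using g by (intro finprod_cong') auto
    then have eq: "v [^] x n \<otimes> power_comb n g x = \<one>"
      using that power_comb_Suc[OF g', of x] by simp
    have dvd: "int p dvd x n"
    proof (rule ccontr)
      assume "\<not> int p dvd x n"
      then have "coprime (x n) (int p)"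
        using p by (meson prime_imp_coprime prime_int_nat_transfer coprime_commute prime_nat_int_transfer)
      then obtain c where "[x n * c = 1] (mod int p)"
        using cong_solve_coprime_int by blast
      then obtain d where d: "x n * c = 1 + int p * d"
        by (metis cong_iff_lin cong_sym)
      have "v [^] x n = inv power_comb n g x"
        using eq g v by (intro inv_equality[symmetric]) auto
      then have "(v [^] x n) [^] c = power_comb n g (\<lambda>i. x i * - c)"
        using g by (simp only: power_comb_scale int_pow_inv int_pow_neg power_comb_closed)
      moreover have "(v [^] x n) [^] c = v"
        using v exponent[OF v(1)] d
        by (simp add: int_pow_pow int_pow_mult int_pow_int flip: int_pow_pow[of v "int p" d])
      ultimately show False
        using v by (metis rangeI)
    qed
    then have "v [^] x n = \<one>"
      using v exponent[OF v(1)] by (auto simp: int_pow_int simp flip: int_pow_pow elim!: dvdE)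
    then have "power_comb n g x = \<one>"
      using eq g by simp
    then show ?thesis
      using indep dvd by (auto simp: independent_mod_def less_Suc_eq)
  qed
  then show ?thesis
    using g' by (simp add: independent_mod_def)
qed

end

section \<open>Vectors over the prime field and coordinates of elementary abelian groups\<close>

lemma Fp_space_iff:
  "x \<in> Fp_space p n \<longleftrightarrow> x \<in> extensional {..<n} \<and> (\<forall>i<n. 0 \<le> x i \<and> x i < int p)"
  by (auto simp: Fp_space_def residue_ring_def PiE_def Pi_def)

lemma card_Fp_space: "card (Fp_space p n) = p ^ n"
  by (simp add: Fp_space_def residue_ring_def card_PiE)

lemma Fp_space_eqI:
  "x \<in> Fp_space p n \<Longrightarrow> y \<in> Fp_space p n \<Longrightarrow> (\<And>i. i < n \<Longrightarrow> x i mod int p = y i mod int p) \<Longrightarrow> x = y"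
  by (rule extensionalityI[of _ "{..<n}"]) (auto simp: Fp_space_iff)

lemma Fp_add_closed: "p > 0 \<Longrightarrow> Fp_add p n x y \<in> Fp_space p n"
  by (auto simp: Fp_add_def Fp_space_iff residue_ring_def)

lemma Fp_zero_in: "p > 0 \<Longrightarrow> Fp_zero p n \<in> Fp_space p n"
  by (auto simp: Fp_zero_def Fp_space_iff residue_ring_def)

lemma Fp_add_zero: "x \<in> Fp_space p n \<Longrightarrow> Fp_add p n (Fp_zero p n) x = x"
  by (rule extensionalityI[of _ "{..<n}"]) (auto simp: Fp_zero_def Fp_add_def Fp_space_iff residue_ring_def)

lemma Fp_diff_nth:
  "p > 1 \<Longrightarrow> i < n \<Longrightarrow> Fp_diff p n x y i = (x i - y i) mod int p"
proof -
  assume "p > 1" "i < n"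
  then interpret R: residues "int p" "residue_ring (int p)"
    by unfold_locales auto
  show ?thesis
    using \<open>i < n\<close> by (simp add: Fp_diff_def a_minus_def R.res_add_eq R.res_neg_eq mod_simps)
qed

lemma Fp_diff_closed: "p > 1 \<Longrightarrow> Fp_diff p n x y \<in> Fp_space p n"
  using Fp_diff_nth[of p _ n x y] by (auto simp: Fp_space_iff Fp_diff_def)

text \<open>This turns the differences in the definition of \<open>bent\<close> into sums, so that
  compatibility of the later maps with \<open>Fp_add\<close> suffices.\<close>

lemma Fp_diff_eq_iff:
  assumes p: "p > 1" and xyz: "x \<in> Fp_space p n" "y \<in> Fp_space p n" "z \<in> Fp_space p n"
  shows "Fp_diff p n x y = z \<longleftrightarrow> Fp_add p n z y = x"
proof
  assume z: "Fp_diff p n x y = z"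
  show "Fp_add p n z y = x"
  proof (rule Fp_space_eqI)
    show "Fp_add p n z y \<in> Fp_space p n"
      using p by (simp add: Fp_add_closed)
  qed (use p xyz z Fp_diff_nth[OF p, of _ n x y] in
      \<open>auto simp: Fp_add_def residue_ring_def mod_simps\<close>)
next
  assume x: "Fp_add p n z y = x"
  show "Fp_diff p n x y = z"
    using p xyz x Fp_diff_nth[OF p, of _ n x y]
    by (intro Fp_space_eqI) (auto simp: Fp_diff_closed Fp_add_def residue_ring_def mod_simps)
qed

text \<open>An independent family of length \<open>n\<close> yields \<open>p ^ n\<close> distinct
  elements, which bounds its length by \<open>k\<close> and so gives one of maximal length.
  Maximality makes it span, since any element outside the span would extend it, and comparing orders
  shows that its length is \<open>k\<close>.\<close>

theorem (in comm_group) elementary_abelian_coordinates: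
  assumes p: "prime p" and exponent: "\<And>z. z \<in> carrier G \<Longrightarrow> z [^] p = \<one>"
    and card: "card (carrier G) = p ^ k"
  shows "\<exists>\<phi>. bij_betw \<phi> (Fp_space p k) (carrier G) \<and>
    (\<forall>x\<in>Fp_space p k. \<forall>y\<in>Fp_space p k. \<phi> (Fp_add p k x y) = \<phi> x \<otimes> \<phi> y)"
proof -
  have p1: "p > 1"
    using p by (rule prime_gt_1_nat)
  have fin: "finite (carrier G)"
    using card p1 by (intro card_ge_0_finite) simp
  have inj: "inj_on (power_comb n g) (Fp_space p n)" if indep: "independent_mod p n g" for n g
  proof (rule inj_onI)
    fix x y assume xy: "x \<in> Fp_space p n" "y \<in> Fp_space p n" "power_comb n g x = power_comb n g y"
    have g: "g \<in> {..<n} \<rightarrow> carrier G"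
      using indep by (simp add: independent_mod_def)
    have "power_comb n g (\<lambda>i. x i - y i) = \<one>"
      using xy g by (simp add: power_comb_diff)
    then have "int p dvd x i - y i" if "i < n" for i
      using indep that by (auto simp: independent_mod_def)
    then show "x = y"
      using xy by (intro Fp_space_eqI) (auto simp: mod_eq_dvd_iff)
  qed
  have bound: "n \<le> k" if indep: "\<exists>g. independent_mod p n g" for n
  proof -
    obtain g where g: "independent_mod p n g" using indep ..
    have "p ^ n = card (power_comb n g ` Fp_space p n)"
      using card_image[OF inj[OF g]] by (simp add: card_Fp_space)
    also have "\<dots> \<le> card (carrier G)"
      using g fin by (intro card_mono) (auto simp: independent_mod_def)
    finally show ?thesis
      using card p1 by simp
  qed
  have "independent_mod p 0 g" for g
    by (simp add: independent_mod_def)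
  then have ex: "\<exists>g. independent_mod p 0 g" by blast
  define n where "n = Greatest (\<lambda>n. \<exists>g. independent_mod p n g)"
  have "\<exists>g. independent_mod p n g"
    unfolding n_def using ex bound by (rule GreatestI_nat)
  then obtain g where indep: "independent_mod p n g" ..
  have g: "g \<in> {..<n} \<rightarrow> carrier G"
    using indep by (simp add: independent_mod_def)
  have "carrier G \<subseteq> power_comb n g ` Fp_space p n"
  proof
    fix v assume v: "v \<in> carrier G"
    have "v \<in> range (power_comb n g)"
    proof (rule ccontr)
      assume "v \<notin> range (power_comb n g)"
      then have "\<exists>g. independent_mod p (Suc n) g"
        using independent_mod_extend[OF p exponent indep v] by blast
      then have "Suc n \<le> n"
        unfolding n_def using bound by (rule Greatest_le_nat)
      then show False by simp
    qed
    then obtain x where x: "v = power_comb n g x" by blast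
    \<comment> \<open>The span was taken with all integer coefficients; since \<open>p\<close>-th
      powers are trivial, residues already give every element.\<close>
    have "power_comb n g x = power_comb n g (\<lambda>i\<in>{..<n}. x i mod int p)"
      by (rule power_comb_cong[OF exponent g]) auto
    moreover have "(\<lambda>i\<in>{..<n}. x i mod int p) \<in> Fp_space p n"
      using p1 by (auto simp: Fp_space_iff)
    ultimately show "v \<in> power_comb n g ` Fp_space p n"
      using x by blast
  qed
  then have bij: "bij_betw (power_comb n g) (Fp_space p n) (carrier G)"
    using inj[OF indep] g by (auto simp: bij_betw_def)
  then have "p ^ n = p ^ k"
    using bij_betw_same_card[OF bij] card by (simp add: card_Fp_space)
  then have "n = k"
    using p1 by simp
  moreover have "power_comb n g (Fp_add p n x y) = power_comb n g x \<otimes> power_comb n g y" for x y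
  proof -
    have "power_comb n g (Fp_add p n x y) = power_comb n g (\<lambda>i. x i + y i)"
      by (rule power_comb_cong[OF exponent g]) (auto simp: Fp_add_def residue_ring_def)
    then show ?thesis using g by (simp add: power_comb_add)
  qed
  ultimately show ?thesis
    using bij by blast
qed


text \<open>The map keeps the first \<open>m\<close> coordinates, and the other \<open>k - m\<close>
  are free on each fibre.\<close>

lemma (in comm_group) elementary_abelian_projection:
  assumes p: "prime p" and exponent: "\<And>z. z \<in> carrier G \<Longrightarrow> z [^] p = \<one>"
    and card: "card (carrier G) = p ^ k" and m: "m \<le> k"
  shows "\<exists>\<pi>. \<pi> \<in> carrier G \<rightarrow> Fp_space p m \<and>
    (\<forall>x\<in>carrier G. \<forall>y\<in>carrier G. \<pi> (x \<otimes> y) = Fp_add p m (\<pi> x) (\<pi> y)) \<and>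
    (\<forall>b\<in>Fp_space p m. card {x \<in> carrier G. \<pi> x = b} = p ^ (k - m))"
proof -
  have p0: "p > 0"
    using p by (rule prime_gt_0_nat)
  obtain \<phi> where \<phi>: "bij_betw \<phi> (Fp_space p k) (carrier G)"
    and hom: "\<And>x y. x \<in> Fp_space p k \<Longrightarrow> y \<in> Fp_space p k \<Longrightarrow> \<phi> (Fp_add p k x y) = \<phi> x \<otimes> \<phi> y"
    using elementary_abelian_coordinates[OF p exponent card] by blast
  define \<psi> where "\<psi> = inv_into (Fp_space p k) \<phi>"
  have \<psi>: "bij_betw \<psi> (carrier G) (Fp_space p k)"
    unfolding \<psi>_def by (rule bij_betw_inv_into[OF \<phi>])
  have \<phi>\<psi>: "\<phi> (\<psi> x) = x" if "x \<in> carrier G" for x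
    unfolding \<psi>_def using \<phi> that by (rule bij_betw_inv_into_right)
  have \<psi>\<phi>: "\<psi> (\<phi> x) = x" if "x \<in> Fp_space p k" for x
    unfolding \<psi>_def using \<phi> that by (rule bij_betw_inv_into_left)
  have \<psi>_in: "\<psi> x \<in> Fp_space p k" if "x \<in> carrier G" for x
    using \<psi> that by (auto simp: bij_betw_def)
  have \<psi>_hom: "\<psi> (x \<otimes> y) = Fp_add p k (\<psi> x) (\<psi> y)" if "x \<in> carrier G" "y \<in> carrier G" for x y
    using hom[of "\<psi> x" "\<psi> y"] \<psi>\<phi>[of "Fp_add p k (\<psi> x) (\<psi> y)"] that
    by (simp add: \<phi>\<psi> \<psi>_in Fp_add_closed p0)
  define \<pi> where "\<pi> x = restrict (\<psi> x) {..<m}" for x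
  have "\<pi> \<in> carrier G \<rightarrow> Fp_space p m"
    using \<psi>_in m by (auto simp: \<pi>_def Fp_space_iff)
  moreover have "\<pi> (x \<otimes> y) = Fp_add p m (\<pi> x) (\<pi> y)" if "x \<in> carrier G" "y \<in> carrier G" for x y
    using \<psi>_hom[OF that] m by (auto simp: \<pi>_def Fp_add_def)
  moreover have "card {x \<in> carrier G. \<pi> x = b} = p ^ (k - m)" if b: "b \<in> Fp_space p m" for b
  proof -
    have "bij_betw \<psi> {x \<in> carrier G. \<pi> x = b} {y \<in> Fp_space p k. restrict y {..<m} = b}"
      by (rule bij_betw_Collect[OF \<psi>]) (simp add: \<pi>_def)
    then have "card {x \<in> carrier G. \<pi> x = b} = card {y \<in> Fp_space p k. restrict y {..<m} = b}"
      by (rule bij_betw_same_card)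
    also have "{y \<in> Fp_space p k. restrict y {..<m} = b}
        = (\<Pi>\<^sub>E i\<in>{..<k}. if i < m then {b i} else {0..int p - 1})"
      (is "?A = ?B")
    proof
      show "?A \<subseteq> ?B"
        by (auto simp: Fp_space_iff PiE_def)
      show "?B \<subseteq> ?A"
      proof
        fix y assume y: "y \<in> ?B"
        have y1: "y i = b i" if "i < m" for i
          using PiE_mem[OF y, of i] that m by auto
        have y2: "0 \<le> y i \<and> y i < int p" if "i < k" for i
          using PiE_mem[OF y, of i] that m b by (auto simp: Fp_space_iff split: if_splits)
        have "restrict y {..<m} = b"
          using y1 b by (intro extensionalityI[of _ "{..<m}"]) (auto simp: Fp_space_iff)
        then show "y \<in> ?A"
          using y2 y by (auto simp: Fp_space_iff PiE_def)
      qed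
    qed
    also have "card \<dots> = (\<Prod>i<k. if i < m then 1 else p)"
      by (subst card_PiE) (auto intro!: prod.cong)
    also have "\<dots> = (\<Prod>i\<in>{m..<k}. p)"
      by (intro prod.mono_neutral_cong_right) auto
    finally show ?thesis by simp
  qed
  ultimately show ?thesis by blast
qed

section \<open>From perfect nonlinear maps between groups to bent functions\<close>

lemma card_fibre_comp:
  assumes "finite A" "finite C" "h \<in> A \<rightarrow> C"
  shows "card {x \<in> A. \<pi> (h x) = b} = (\<Sum>c\<in>{c \<in> C. \<pi> c = b}. card {x \<in> A. h x = c})"
proof -
  have "{x \<in> A. \<pi> (h x) = b} = (\<Union>c\<in>{c \<in> C. \<pi> c = b}. {x \<in> A. h x = c})"
    using assms(3) by auto
  then show ?thesis
    using assms(1,2) by (simp only:) (rule card_UN_disjoint, auto)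
qed

text \<open>As \<pi> is additive, a derivative of the composite is \<pi> after a derivative of
  \<open>f\<close>. Its fibres are therefore unions of \<open>p ^ (k - m)\<close> fibres of size
  \<open>p ^ (n - k)\<close>, which gives \<open>p ^ (n - m)\<close>. The fibres of the composite
  itself split in the same way, and the identity of \<open>H\<close> occurs only above the zero
  vector.\<close>

theorem perfect_nonlinear_imp_bent:
  fixes G :: "('a, 'c) monoid_scheme" and H :: "('b, 'd) monoid_scheme"
  assumes p: "prime p" and G: "comm_group G" and H: "comm_group H"
    and expG: "\<And>z. z \<in> carrier G \<Longrightarrow> z [^]\<^bsub>G\<^esub> p = \<one>\<^bsub>G\<^esub>"
    and expH: "\<And>z. z \<in> carrier H \<Longrightarrow> z [^]\<^bsub>H\<^esub> p = \<one>\<^bsub>H\<^esub>"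
    and cardG: "card (carrier G) = p ^ n" and cardH: "card (carrier H) = p ^ k"
    and mk: "m \<le> k" and kn: "k \<le> n"
    and f: "f \<in> carrier G \<rightarrow> carrier H"
    and nonlinear: "\<And>a b. a \<in> carrier G \<Longrightarrow> a \<noteq> \<one>\<^bsub>G\<^esub> \<Longrightarrow> b \<in> carrier H \<Longrightarrow>
      card {x \<in> carrier G. f (x \<otimes>\<^bsub>G\<^esub> a) = b \<otimes>\<^bsub>H\<^esub> f x} = p ^ (n - k)"
    and fibre_one: "card {x \<in> carrier G. f x = \<one>\<^bsub>H\<^esub>} = s"
    and fibre_other: "\<And>c. c \<in> carrier H \<Longrightarrow> c \<noteq> \<one>\<^bsub>H\<^esub> \<Longrightarrow> card {x \<in> carrier G. f x = c} = t"
  shows "\<exists>F. bent p n m F \<and> card (fibre p n F (Fp_zero p m)) = s + (p ^ (k - m) - 1) * t \<and>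
    (\<forall>\<beta>\<in>Fp_space p m - {Fp_zero p m}. card (fibre p n F \<beta>) = p ^ (k - m) * t)"
proof -
  interpret G: comm_group G by (rule G)
  interpret H: comm_group H by (rule H)
  have p1: "p > 1" using p by (rule prime_gt_1_nat)
  then have p0: "p > 0" by simp
  have finG: "finite (carrier G)" and finH: "finite (carrier H)"
    using cardG cardH p0 by (auto intro!: card_ge_0_finite)
  obtain \<phi> where \<phi>: "bij_betw \<phi> (Fp_space p n) (carrier G)"
    and \<phi>_hom: "\<And>x y. x \<in> Fp_space p n \<Longrightarrow> y \<in> Fp_space p n \<Longrightarrow> \<phi> (Fp_add p n x y) = \<phi> x \<otimes>\<^bsub>G\<^esub> \<phi> y"
    using G.elementary_abelian_coordinates[OF p expG cardG] by blast
  have \<phi>_in: "\<phi> x \<in> carrier G" if "x \<in> Fp_space p n" for x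
    using \<phi> that by (auto simp: bij_betw_def)
  obtain \<pi> where \<pi>: "\<pi> \<in> carrier H \<rightarrow> Fp_space p m"
    and \<pi>_hom: "\<And>x y. x \<in> carrier H \<Longrightarrow> y \<in> carrier H \<Longrightarrow> \<pi> (x \<otimes>\<^bsub>H\<^esub> y) = Fp_add p m (\<pi> x) (\<pi> y)"
    and \<pi>_card: "\<And>b. b \<in> Fp_space p m \<Longrightarrow> card {x \<in> carrier H. \<pi> x = b} = p ^ (k - m)"
    using H.elementary_abelian_projection[OF p expH cardH mk] by blast
  \<comment> \<open>The zero vector is idempotent under addition, so its image is an idempotent of a
    group, hence the identity.\<close>
  have \<phi>_zero: "\<phi> (Fp_zero p n) = \<one>\<^bsub>G\<^esub>"
    using \<phi>_hom[of "Fp_zero p n" "Fp_zero p n"] \<phi>_in[of "Fp_zero p n"]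
    by (simp add: Fp_zero_in p0 Fp_add_zero)
  have \<pi>_one: "\<pi> \<one>\<^bsub>H\<^esub> = Fp_zero p m"
  proof (rule Fp_space_eqI)
    fix i assume i: "i < m"
    have "Fp_add p m (\<pi> \<one>\<^bsub>H\<^esub>) (\<pi> \<one>\<^bsub>H\<^esub>) = \<pi> \<one>\<^bsub>H\<^esub>"
      using \<pi>_hom[of "\<one>\<^bsub>H\<^esub>" "\<one>\<^bsub>H\<^esub>"] by simp
    then have "(\<pi> \<one>\<^bsub>H\<^esub> i + \<pi> \<one>\<^bsub>H\<^esub> i) mod int p = \<pi> \<one>\<^bsub>H\<^esub> i"
      using i by (auto simp: Fp_add_def residue_ring_def dest: fun_cong[of _ _ i])
    then have "int p dvd \<pi> \<one>\<^bsub>H\<^esub> i"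
      by (metis add_diff_cancel_left' mod_eq_dvd_iff mod_mod_trivial)
    then show "\<pi> \<one>\<^bsub>H\<^esub> i mod int p = Fp_zero p m i mod int p"
      using i by (simp add: Fp_zero_def residue_ring_def)
  qed (use \<pi> p0 Fp_zero_in in auto)
  define F where "F x = \<pi> (f (\<phi> x))" for x
  have F_in: "F x \<in> Fp_space p m" if "x \<in> Fp_space p n" for x
    using \<pi> f \<phi>_in[OF that] by (auto simp: F_def)
  have pull: "card {x \<in> Fp_space p n. P (\<phi> x)} = card {x \<in> carrier G. P x}" for P
  proof (rule bij_betw_same_card)
    show "bij_betw \<phi> {x \<in> Fp_space p n. P (\<phi> x)} {x \<in> carrier G. P x}"
      using \<phi> by (auto simp: bij_betw_def inj_on_def)
  qed
  have "bent p n m F"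
    unfolding bent_def
  proof (intro conjI ballI)
    show "F \<in> Fp_space p n \<rightarrow> Fp_space p m"
      using F_in by auto
    fix a b assume a: "a \<in> Fp_space p n - {Fp_zero p n}" and b: "b \<in> Fp_space p m"
    have a1: "\<phi> a \<in> carrier G" "\<phi> a \<noteq> \<one>\<^bsub>G\<^esub>"
      using a \<phi>_in \<phi>_zero Fp_zero_in[OF p0, of n] inj_onD[OF bij_betw_imp_inj_on[OF \<phi>], of a "Fp_zero p n"]
      by auto
    let ?h = "\<lambda>x. f (x \<otimes>\<^bsub>G\<^esub> \<phi> a) \<otimes>\<^bsub>H\<^esub> inv\<^bsub>H\<^esub> f x"
    have h: "?h \<in> carrier G \<rightarrow> carrier H"
      using f a1 by auto
    have "(Fp_diff p m (F (Fp_add p n x a)) (F x) = b) \<longleftrightarrow> \<pi> (?h (\<phi> x)) = b"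
      if x: "x \<in> Fp_space p n" for x
    proof -
      have fx: "f (\<phi> x) \<in> carrier H" and hx: "?h (\<phi> x) \<in> carrier H"
        using f h \<phi>_in[OF x] by auto
      have "F (Fp_add p n x a) = \<pi> (f (\<phi> x \<otimes>\<^bsub>G\<^esub> \<phi> a))"
        using x a by (simp add: F_def \<phi>_hom)
      \<comment> \<open>Inserting the value at \<phi> x and its inverse exhibits the shifted value
        as a product, to which additivity of \<pi> applies.\<close>
      also have "\<dots> = \<pi> (?h (\<phi> x) \<otimes>\<^bsub>H\<^esub> f (\<phi> x))"
        using f a1 \<phi>_in[OF x] by (simp add: H.m_assoc Pi_def)
      also have "\<dots> = Fp_add p m (\<pi> (?h (\<phi> x))) (F x)"
        using fx hx by (simp only: \<pi>_hom F_def)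
      finally have "Fp_add p m (\<pi> (?h (\<phi> x))) (F x) = F (Fp_add p n x a)" ..
      moreover have "\<pi> (?h (\<phi> x)) \<in> Fp_space p m"
        using \<pi> hx by (rule funcset_mem)
      ultimately have "Fp_diff p m (F (Fp_add p n x a)) (F x) = \<pi> (?h (\<phi> x))"
        using Fp_diff_eq_iff[OF p1 F_in[OF Fp_add_closed[OF p0]] F_in[OF x]] by simp
      then show ?thesis by simp
    qed
    then have "card {x \<in> Fp_space p n. Fp_diff p m (F (Fp_add p n x a)) (F x) = b}
        = card {x \<in> Fp_space p n. \<pi> (?h (\<phi> x)) = b}"
      by (intro arg_cong[of _ _ card]) auto
    also have "\<dots> = card {x \<in> carrier G. \<pi> (?h x) = b}"
      by (rule pull)
    also have "\<dots> = (\<Sum>c\<in>{c \<in> carrier H. \<pi> c = b}. card {x \<in> carrier G. ?h x = c})"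
      by (rule card_fibre_comp[OF finG finH h])
    also have "\<dots> = (\<Sum>c\<in>{c \<in> carrier H. \<pi> c = b}. p ^ (n - k))"
    proof (rule sum.cong[OF refl])
      fix c assume c: "c \<in> {c \<in> carrier H. \<pi> c = b}"
      have "{x \<in> carrier G. ?h x = c} = {x \<in> carrier G. f (x \<otimes>\<^bsub>G\<^esub> \<phi> a) = c \<otimes>\<^bsub>H\<^esub> f x}"
        using c funcset_mem[OF f] a1(1)
        by (intro Collect_cong conj_cong refl) (auto simp: H.m_assoc)
      then show "card {x \<in> carrier G. ?h x = c} = p ^ (n - k)"
        using nonlinear[OF a1, of c] c by simp
    qed
    also have "\<dots> = p ^ (k - m) * p ^ (n - k)"
      using \<pi>_card[OF b] by simp
    also have "\<dots> = p ^ (n - m)"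
      using mk kn by (simp flip: power_add)
    finally show "real (card {x \<in> Fp_space p n. Fp_diff p m (F (Fp_add p n x a)) (F x) = b})
        = real p powr (real n - real m)"
      using mk kn p0 by (simp add: powr_realpow flip: of_nat_diff)
  qed
  moreover have fib: "card (fibre p n F \<beta>) = (\<Sum>c\<in>{c \<in> carrier H. \<pi> c = \<beta>}. card {x \<in> carrier G. f x = c})" for \<beta>
    using pull[of "\<lambda>y. \<pi> (f y) = \<beta>"] card_fibre_comp[OF finG finH f, of \<pi> \<beta>] by (simp add: fibre_def F_def)
  have "card (fibre p n F (Fp_zero p m)) = s + (p ^ (k - m) - 1) * t"
  proof -
    let ?C = "{c \<in> carrier H. \<pi> c = Fp_zero p m}"
    have C: "finite ?C" "\<one>\<^bsub>H\<^esub> \<in> ?C" "card ?C = p ^ (k - m)"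
      using finH \<pi>_one \<pi>_card[OF Fp_zero_in[OF p0]] by auto
    have "card (fibre p n F (Fp_zero p m)) = s + (\<Sum>c\<in>?C - {\<one>\<^bsub>H\<^esub>}. card {x \<in> carrier G. f x = c})"
      unfolding fib fibre_one[symmetric] using C by (intro sum.remove)
    also have "(\<Sum>c\<in>?C - {\<one>\<^bsub>H\<^esub>}. card {x \<in> carrier G. f x = c}) = (\<Sum>c\<in>?C - {\<one>\<^bsub>H\<^esub>}. t)"
      by (intro sum.cong) (auto simp: fibre_other)
    finally show ?thesis
      using C by (simp add: card_Diff_singleton)
  qed
  moreover have "card (fibre p n F \<beta>) = p ^ (k - m) * t" if \<beta>: "\<beta> \<in> Fp_space p m - {Fp_zero p m}" for \<beta>
  proof -
    have "card (fibre p n F \<beta>) = (\<Sum>c\<in>{c \<in> carrier H. \<pi> c = \<beta>}. t)"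
      unfolding fib using \<beta> \<pi>_one by (intro sum.cong) (auto intro!: fibre_other)
    then show ?thesis
      using \<pi>_card[of \<beta>] \<beta> by simp
  qed
  ultimately show ?thesis by blast
qed

section \<open>Norm and multiplication on finite fields\<close>

text \<open>The fibre sizes add up to the size of \<open>A\<close>. If none exceeds \<open>d\<close>
  and their average over \<open>B\<close> is at least \<open>d\<close>, none can fall short.
  Surjectivity comes along when \<open>d\<close> is positive.\<close>

lemma card_fibre_eq_average:
  assumes A: "finite A" and B: "finite B" and f: "f \<in> A \<rightarrow> B"
    and le: "\<And>b. b \<in> B \<Longrightarrow> card {x \<in> A. f x = b} \<le> d" and card: "d * card B \<le> card A"
    and b: "b \<in> B"
  shows "card {x \<in> A. f x = b} = d"
proof (rule ccontr)
  assume "card {x \<in> A. f x = b} \<noteq> d"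
  with le[OF b] have "card {x \<in> A. f x = b} < d" by simp
  then have "(\<Sum>b\<in>B. card {x \<in> A. f x = b}) < (\<Sum>b\<in>B. d)"
    using B b le by (intro sum_strict_mono_ex1) auto
  moreover have "(\<Sum>b\<in>B. card {x \<in> A. f x = b}) = card A"
    \<comment> \<open>With a constant outer map the formula for fibres of a composite says that the
      fibres of \<open>f\<close> partition \<open>A\<close>.\<close>
    using card_fibre_comp[OF A B f, of "\<lambda>_. ()" "()"] by simp
  ultimately show False
    using card by (simp add: mult.commute)
qed

section \<open>Power maps on a finite field\<close>

context field
begin

text \<open>Division by one nonzero solution embeds all solutions into the \<open>d\<close>-th roots
  of unity, for which the bound is known. Without a nonzero solution only zero can remain.\<close>

lemma card_nth_roots_le:
  assumes fin: "finite (carrier R)" and d: "d > 0" and c: "c \<in> carrier R"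
  shows "card {x \<in> carrier R. x [^] (d::nat) = c} \<le> d"
proof (cases "\<exists>x\<in>carrier R - {\<zero>}. x [^] d = c")
  case True
  then obtain y where y: "y \<in> carrier R" "y \<noteq> \<zero>" "y [^] d = c" by blast
  then have yU: "y \<in> Units R" by (simp add: field_Units)
  have "card {x \<in> carrier R. x [^] d = c} \<le> card {x \<in> carrier R. x [^] d = \<one>}"
  proof (rule card_inj_on_le[of "\<lambda>x. x \<otimes> inv y"])
    show "inj_on (\<lambda>x. x \<otimes> inv y) {x \<in> carrier R. x [^] d = c}"
    proof (rule inj_onI)
      fix u v assume uv: "u \<in> {x \<in> carrier R. x [^] d = c}" "v \<in> {x \<in> carrier R. x [^] d = c}"
        "u \<otimes> inv y = v \<otimes> inv y"
      then have "u \<otimes> inv y \<otimes> y = v \<otimes> inv y \<otimes> y" by simp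
      then show "u = v"
        using uv yU by (metis (no_types, lifting) Units_closed Units_inv_closed Units_l_inv m_assoc mem_Collect_eq r_one)
    qed
    have "(x \<otimes> inv y) [^] d = \<one>" if "x \<in> carrier R" "x [^] d = c" for x
    proof -
      have "(x \<otimes> inv y) [^] d = (y \<otimes> inv y) [^] d"
        using that y yU by (simp add: nat_pow_distrib del: Units_r_inv)
      then show ?thesis using yU by simp
    qed
    then show "(\<lambda>x. x \<otimes> inv y) ` {x \<in> carrier R. x [^] d = c} \<subseteq> {x \<in> carrier R. x [^] d = \<one>}"
      using yU by auto
  qed (use fin in auto)
  also have "\<dots> \<le> d"
    using fin d by (intro num_roots_le_deg) auto
  finally show ?thesis .
next
  case False
  then have "card {x \<in> carrier R. x [^] d = c} \<le> card {\<zero>}"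
    by (intro card_mono) auto
  then show ?thesis using d by simp
qed

text \<open>Lagrange's theorem in the multiplicative group, multiplied once more by \<open>x\<close>
  so that zero is covered too.\<close>

lemma pow_card_eq_self:
  assumes fin: "finite (carrier R)" and x: "x \<in> carrier R"
  shows "x [^] card (carrier R) = x"
proof (cases "x = \<zero>")
  case True
  have "card (carrier R) \<noteq> 0"
    using fin x by auto
  then show ?thesis using True by (simp add: nat_pow_zero)
next
  case False
  interpret M: group "Multiplicative_Group.mult_of R" by (rule field_mult_group)
  have "card (carrier R) = Suc (order (Multiplicative_Group.mult_of R))"
    using fin x card_gt_0_iff[of "carrier R"] by (auto simp: order_mult_of order_def)
  moreover have "x [^] order (Multiplicative_Group.mult_of R) = \<one>"
    using M.pow_order_eq_1[of x] x False by (simp add: Multiplicative_Group.nat_pow_mult_of)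
  ultimately show ?thesis using x by simp
qed

end

text \<open>Over the subfield \<open>K\<close> of order \<open>q\<close> the norm of \<open>x\<close> is \<open>x ^ (q + 1)\<close>, and
  \<open>a x ^ q + a ^ q x\<close> is the trace of \<open>a ^ q x\<close>.\<close>

locale quadratic_finite_field = field R for R (structure) +
  fixes p k q :: nat
  assumes p: "prime p" and k: "k > 0" and q: "q = p ^ k"
    and char: "\<And>z. z \<in> carrier R \<Longrightarrow> [p] \<cdot> z = \<zero>"
    and card_carrier: "card (carrier R) = q * q"
begin

definition K where "K = {x \<in> carrier R. x [^] q = x}"

lemma q_gt_1: "q > 1"
  unfolding q using prime_gt_1_nat[OF p] k by (rule one_less_power)

lemma finite_carrier: "finite (carrier R)"
  using card_carrier q_gt_1 by (intro card_ge_0_finite) simp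

lemma subfield_K: "subfield K R"
  using frobenius_fixed_subfield[OF p char, of k] by (simp only: K_def flip: q)

lemma K_carrier: "x \<in> K \<Longrightarrow> x \<in> carrier R"
  by (simp add: K_def)

lemma finite_K: "finite K"
  using finite_carrier by (simp add: K_def)

lemma zero_in_K: "\<zero> \<in> K"
  using q_gt_1 by (simp add: K_def nat_pow_zero)

lemma frobenius_twice: "x \<in> carrier R \<Longrightarrow> (x [^] q) [^] q = x"
  using pow_card_eq_self[OF finite_carrier, of x] by (simp add: nat_pow_pow card_carrier)

lemma frobenius_sum:
  "x \<in> carrier R \<Longrightarrow> y \<in> carrier R \<Longrightarrow> (x \<oplus> y) [^] q = x [^] q \<oplus> y [^] q"
  unfolding q by (rule frobenius_power_add[OF p char])

lemma norm_in_K: "x \<in> carrier R \<Longrightarrow> x [^] (q + 1) \<in> K"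
  by (simp add: K_def nat_pow_distrib frobenius_twice m_comm)

lemma norm_eq_zero_iff: "x \<in> carrier R \<Longrightarrow> x [^] (q + 1) = \<zero> \<longleftrightarrow> x = \<zero>"
proof -
  assume x: "x \<in> carrier R"
  have "x [^] n \<noteq> \<zero>" if "x \<noteq> \<zero>" for n :: nat
    using x that by (induction n) (auto simp: integral_iff)
  then show ?thesis
    using x by (auto simp: integral_iff)
qed

text \<open>Nonzero elements of \<open>K\<close> are roots of unity of order dividing
  \<open>q - 1\<close>, which gives the upper bound. For the lower one, the norm sends the
  \<open>q * q - 1\<close> nonzero elements into the nonzero part of \<open>K\<close>, and at most
  \<open>q + 1\<close> of them share a value.\<close>

lemma card_K: "card K = q"
proof (rule antisym)
  have "K \<subseteq> insert \<zero> {x \<in> carrier R. x [^] (q - 1) = \<one>}"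
  proof
    fix x assume x: "x \<in> K"
    have "x [^] (q - 1) = \<one>" if "x \<noteq> \<zero>"
    proof -
      have "x \<otimes> x [^] (q - 1) = x \<otimes> \<one>"
        using x q_gt_1 nat_pow_Suc2[of x "q - 1"] by (simp add: K_def)
      then show ?thesis
        using x that by (metis K_carrier m_lcancel nat_pow_closed one_closed)
    qed
    then show "x \<in> insert \<zero> {x \<in> carrier R. x [^] (q - 1) = \<one>}"
      using K_carrier[OF x] by blast
  qed
  then have "card K \<le> card (insert \<zero> {x \<in> carrier R. x [^] (q - 1) = \<one>})"
    using finite_carrier by (intro card_mono) auto
  also have "\<dots> \<le> Suc (card {x \<in> carrier R. x [^] (q - 1) = \<one>})"
    by (rule card_insert_le_m1) auto
  also have "\<dots> \<le> Suc (q - 1)"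
    using q_gt_1 by (intro Suc_le_mono[THEN iffD2] card_nth_roots_le finite_carrier) auto
  finally show "card K \<le> q"
    using q_gt_1 by simp
next
  have "q * q - 1 = card (carrier R - {\<zero>})"
    using finite_carrier by (simp add: card_Diff_singleton card_carrier)
  also have "carrier R - {\<zero>} \<subseteq> (\<Union>c\<in>K - {\<zero>}. {x \<in> carrier R. x [^] (q + 1) = c})"
    using norm_in_K norm_eq_zero_iff by blast
  then have "card (carrier R - {\<zero>}) \<le> card (\<Union>c\<in>K - {\<zero>}. {x \<in> carrier R. x [^] (q + 1) = c})"
    using finite_carrier finite_K by (intro card_mono) auto
  also have "\<dots> \<le> (\<Sum>c\<in>K - {\<zero>}. card {x \<in> carrier R. x [^] (q + 1) = c})"
    using finite_K by (intro card_UN_le) auto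
  also have "\<dots> \<le> (\<Sum>c\<in>K - {\<zero>}. q + 1)"
    using K_carrier by (intro sum_mono card_nth_roots_le finite_carrier) auto
  also have "\<dots> = (card K - 1) * (q + 1)"
    using finite_K zero_in_K by (simp add: card_Diff_singleton)
  finally have "(q - 1) * (q + 1) \<le> (card K - 1) * (q + 1)"
    by (simp add: algebra_simps diff_mult_distrib)
  then show "q \<le> card K"
    using q_gt_1 by (simp only: mult_le_cancel2) linarith
qed

text \<open>The bound \<open>q + 1\<close> from root counting is attained because
  \<open>(q + 1) * (q - 1)\<close> is the number of nonzero elements. Zero has to be removed on both
  sides, as its fibre is a single point and would spoil the average.\<close>

lemma card_norm_fibre:
  assumes c: "c \<in> K" "c \<noteq> \<zero>"
  shows "card {x \<in> carrier R. x [^] (q + 1) = c} = q + 1"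
proof -
  have "card {x \<in> carrier R - {\<zero>}. x [^] (q + 1) = c} = q + 1"
  proof (rule card_fibre_eq_average[where B = "K - {\<zero>}"])
    show "(\<lambda>x. x [^] (q + 1)) \<in> carrier R - {\<zero>} \<rightarrow> K - {\<zero>}"
      using norm_in_K norm_eq_zero_iff by blast
    show "card {x \<in> carrier R - {\<zero>}. x [^] (q + 1) = b} \<le> q + 1" if "b \<in> K - {\<zero>}" for b
    proof -
      have "card {x \<in> carrier R - {\<zero>}. x [^] (q + 1) = b} \<le> card {x \<in> carrier R. x [^] (q + 1) = b}"
        using finite_carrier by (intro card_mono) auto
      also have "\<dots> \<le> q + 1"
        using that K_carrier by (intro card_nth_roots_le finite_carrier) auto
      finally show ?thesis .
    qed
    show "(q + 1) * card (K - {\<zero>}) \<le> card (carrier R - {\<zero>})"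
      using finite_carrier finite_K zero_in_K
      by (simp add: card_Diff_singleton card_carrier card_K algebra_simps diff_mult_distrib2)
  qed (use finite_carrier finite_K c in auto)
  also have "{x \<in> carrier R - {\<zero>}. x [^] (q + 1) = c} = {x \<in> carrier R. x [^] (q + 1) = c}"
    using c norm_eq_zero_iff by blast
  finally show ?thesis .
qed

text \<open>The map is additive with values in \<open>K\<close>, so every nonempty fibre is a
  translate of the kernel. The kernel has at most \<open>q\<close> elements, and \<open>q\<close>
  fibres of at most \<open>q\<close> elements must fill all \<open>q * q\<close>.\<close>

lemma card_trace_fibre:
  assumes a: "a \<in> carrier R" "a \<noteq> \<zero>" and b: "b \<in> K"
  shows "card {x \<in> carrier R. a \<otimes> x [^] q \<oplus> a [^] q \<otimes> x = b} = q"
proof -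
  define T where "T x = a \<otimes> x [^] q \<oplus> a [^] q \<otimes> x" for x
  have T_closed [simp]: "T x \<in> carrier R" if "x \<in> carrier R" for x
    using a that by (simp add: T_def)
  have T_K: "T x \<in> K" if x: "x \<in> carrier R" for x
  proof -
    have "T x [^] q = a [^] q \<otimes> x \<oplus> a \<otimes> x [^] q"
      using a x by (simp add: T_def frobenius_sum nat_pow_distrib frobenius_twice)
    then show ?thesis
      using a x by (simp add: K_def T_def a_comm)
  qed
  have kernel: "card {x \<in> carrier R. T x = \<zero>} \<le> q"
  proof -
    have "{x \<in> carrier R. T x = \<zero>} \<subseteq> insert \<zero> {x \<in> carrier R. x [^] (q - 1) = \<ominus> (a [^] (q - 1))}"
    proof
      fix x assume "x \<in> {x \<in> carrier R. T x = \<zero>}"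
      then have x: "x \<in> carrier R" and Tx: "T x = \<zero>" by auto
      have pow: "y [^] q = y \<otimes> y [^] (q - 1)" if "y \<in> carrier R" for y
        using q_gt_1 nat_pow_Suc2[OF that, of "q - 1"] by simp
      have "x [^] (q - 1) = \<ominus> (a [^] (q - 1))" if "x \<noteq> \<zero>"
      proof -
        let ?u = "x [^] (q - 1)" and ?v = "a [^] (q - 1)"
        \<comment> \<open>Taking \<open>a \<otimes> x\<close> out of \<open>T x\<close> reduces the
          nonzero part of the kernel to an equation of degree \<open>q - 1\<close>.\<close>
        have "(a \<otimes> x) \<otimes> (?u \<oplus> ?v) = a \<otimes> (x \<otimes> ?u) \<oplus> (a \<otimes> ?v) \<otimes> x"
          using a x nat_pow_closed[of x "q - 1"] nat_pow_closed[of a "q - 1"] by algebra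
        also have "\<dots> = \<zero>"
          using Tx a x by (simp add: T_def pow)
        finally have "?u \<oplus> ?v = \<zero>"
          using a x that by (auto simp: integral_iff)
        then show ?thesis
          using a x by (metis minus_equality nat_pow_closed)
      qed
      then show "x \<in> insert \<zero> {x \<in> carrier R. x [^] (q - 1) = \<ominus> (a [^] (q - 1))}"
        using x by blast
    qed
    then have "card {x \<in> carrier R. T x = \<zero>}
        \<le> card (insert \<zero> {x \<in> carrier R. x [^] (q - 1) = \<ominus> (a [^] (q - 1))})"
      using finite_carrier by (intro card_mono) auto
    also have "\<dots> \<le> Suc (card {x \<in> carrier R. x [^] (q - 1) = \<ominus> (a [^] (q - 1))})"
      by (rule card_insert_le_m1) auto
    also have "\<dots> \<le> Suc (q - 1)"
      using q_gt_1 a by (intro Suc_le_mono[THEN iffD2] card_nth_roots_le finite_carrier) auto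
    finally show ?thesis
      using q_gt_1 by simp
  qed
  have T_diff: "T (x \<ominus> y) = T x \<ominus> T y" if "x \<in> carrier R" "y \<in> carrier R" for x y
  proof -
    have "(x \<ominus> y) [^] q = x [^] q \<ominus> y [^] q"
      using that frobenius_sum[of x "\<ominus> y"] frobenius_power_minus[OF p char that(2), of k]
      by (simp add: a_minus_def q)
    moreover have "a \<otimes> (u \<ominus> v) \<oplus> c \<otimes> (x \<ominus> y) = (a \<otimes> u \<oplus> c \<otimes> x) \<ominus> (a \<otimes> v \<oplus> c \<otimes> y)"
      if "u \<in> carrier R" "v \<in> carrier R" "c \<in> carrier R" for u v c
      using that a(1) \<open>x \<in> carrier R\<close> \<open>y \<in> carrier R\<close> by algebra
    ultimately show ?thesis
      using a(1) that by (simp add: T_def)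
  qed
  have "card {x \<in> carrier R. T x = b} = q"
  proof (rule card_fibre_eq_average[OF finite_carrier finite_K _ _ _ b])
    fix b
    show "card {x \<in> carrier R. T x = b} \<le> q"
    proof (cases "\<exists>y\<in>carrier R. T y = b")
      case True
      then obtain y where y: "y \<in> carrier R" "T y = b" by blast
      have "card {x \<in> carrier R. T x = b} \<le> card {x \<in> carrier R. T x = \<zero>}"
      proof (rule card_inj_on_le[of "\<lambda>x. x \<ominus> y"])
        show "inj_on (\<lambda>x. x \<ominus> y) {x \<in> carrier R. T x = b}"
          using y by (intro inj_onI) (simp add: a_minus_def)
        show "(\<lambda>x. x \<ominus> y) ` {x \<in> carrier R. T x = b} \<subseteq> {x \<in> carrier R. T x = \<zero>}"
          using y by (auto simp: T_diff)
      qed (use finite_carrier in auto)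
      then show ?thesis using kernel by simp
    next
      case False
      then have empty: "{x \<in> carrier R. T x = b} = {}" by blast
      show ?thesis unfolding empty by simp
    qed
  qed (use T_K card_carrier card_K in auto)
  then show ?thesis
    by (simp only: T_def)
qed

text \<open>In the expanded norm of the sum the norm of \<open>x\<close> cancels, which leaves the
  trace form plus the norm of \<open>a\<close>. That norm lies in \<open>K\<close>, so the new right
  side is again a value to which the count of trace fibres applies.\<close>

lemma card_norm_derivative_fibre:
  assumes a: "a \<in> carrier R" "a \<noteq> \<zero>" and b: "b \<in> K"
  shows "card {x \<in> carrier R. (x \<oplus> a) [^] (q + 1) = b \<oplus> x [^] (q + 1)} = q"
proof -
  have Na: "a [^] (q + 1) \<in> K"
    using a by (intro norm_in_K)
  have b': "b \<ominus> a [^] (q + 1) \<in> K"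
    unfolding a_minus_def using b Na subringE(5,7)[OF subfieldE(1)[OF subfield_K]] by blast
  have "(x \<oplus> a) [^] (q + 1) = b \<oplus> x [^] (q + 1) \<longleftrightarrow> a \<otimes> x [^] q \<oplus> a [^] q \<otimes> x = b \<ominus> a [^] (q + 1)"
    if x: "x \<in> carrier R" for x
  proof -
    let ?T = "a \<otimes> x [^] q \<oplus> a [^] q \<otimes> x"
    have cl: "b \<in> carrier R" "x [^] q \<in> carrier R" "a [^] q \<in> carrier R"
      using b x a K_carrier by auto
    have "(x \<oplus> a) [^] (q + 1) = (x [^] q \<oplus> a [^] q) \<otimes> (x \<oplus> a)"
      using a x by (simp add: frobenius_sum)
    also have "\<dots> = ?T \<oplus> a [^] (q + 1) \<oplus> x [^] (q + 1)"
    proof -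
      have "(u \<oplus> v) \<otimes> (x \<oplus> a) = (a \<otimes> u \<oplus> v \<otimes> x) \<oplus> v \<otimes> a \<oplus> u \<otimes> x"
        if "u \<in> carrier R" "v \<in> carrier R" for u v
        using that a(1) x by algebra
      then show ?thesis using cl by simp
    qed
    finally have 1: "(x \<oplus> a) [^] (q + 1) = ?T \<oplus> a [^] (q + 1) \<oplus> x [^] (q + 1)" .
    have cl': "?T \<in> carrier R" "a [^] (q + 1) \<in> carrier R" "x [^] (q + 1) \<in> carrier R"
      using cl a x by auto
    have "?T \<oplus> a [^] (q + 1) \<oplus> x [^] (q + 1) = b \<oplus> x [^] (q + 1) \<longleftrightarrow> ?T \<oplus> a [^] (q + 1) = b"
      using cl cl' by (intro add.right_cancel) auto
    also have "\<dots> \<longleftrightarrow> ?T = b \<ominus> a [^] (q + 1)"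
      using cl(1) cl'(1,2) add.inv_solve_right[of ?T b "a [^] (q + 1)"] by (auto simp: a_minus_def)
    finally show ?thesis unfolding 1 .
  qed
  then have "{x \<in> carrier R. (x \<oplus> a) [^] (q + 1) = b \<oplus> x [^] (q + 1)}
      = {x \<in> carrier R. a \<otimes> x [^] q \<oplus> a [^] q \<otimes> x = b \<ominus> a [^] (q + 1)}"
    by blast
  then show ?thesis
    using card_trace_fibre[OF a b'] by simp
qed

end

section \<open>The multiplication map on pairs\<close>

context field
begin

text \<open>The fibre is the union of the two coordinate axes, whose common point is counted
  once.\<close>

lemma card_product_fibre_zero:
  assumes fin: "finite (carrier R)"
  shows "card {z \<in> carrier R \<times> carrier R. fst z \<otimes> snd z = \<zero>} = 2 * card (carrier R) - 1"
proof -
  have "{z \<in> carrier R \<times> carrier R. fst z \<otimes> snd z = \<zero>}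
      = ({\<zero>} \<times> carrier R) \<union> ((carrier R - {\<zero>}) \<times> {\<zero>})"
    by (auto simp: integral_iff)
  also have "card \<dots> = card (carrier R) + (card (carrier R) - 1)"
    using fin by (subst card_Un_disjoint) (auto simp: card_cartesian_product card_Diff_singleton)
  finally show ?thesis
    using fin card_gt_0_iff[of "carrier R"] by auto
qed

lemma card_product_fibre:
  assumes fin: "finite (carrier R)" and c: "c \<in> carrier R" "c \<noteq> \<zero>"
  shows "card {z \<in> carrier R \<times> carrier R. fst z \<otimes> snd z = c} = card (carrier R) - 1"
proof -
  have "bij_betw (\<lambda>x. (x, inv x \<otimes> c)) (carrier R - {\<zero>}) {z \<in> carrier R \<times> carrier R. fst z \<otimes> snd z = c}"
  proof (rule bij_betw_byWitness[where f' = fst])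
    show "\<forall>z\<in>{z \<in> carrier R \<times> carrier R. fst z \<otimes> snd z = c}. (fst z, inv fst z \<otimes> c) = z"
    proof clarsimp
      fix x y assume xy: "x \<in> carrier R" "y \<in> carrier R" "c = x \<otimes> y"
      then have "x \<in> Units R"
        using c by (auto simp: field_Units)
      then show "inv x \<otimes> (x \<otimes> y) = y"
        using xy by (simp flip: m_assoc)
    qed
    show "(\<lambda>x. (x, inv x \<otimes> c)) ` (carrier R - {\<zero>}) \<subseteq> {z \<in> carrier R \<times> carrier R. fst z \<otimes> snd z = c}"
      using c by (auto simp: field_Units simp flip: m_assoc)
    show "fst ` {z \<in> carrier R \<times> carrier R. fst z \<otimes> snd z = c} \<subseteq> carrier R - {\<zero>}"
      using c by auto
  qed auto
  then show ?thesis
    using fin by (simp add: bij_betw_same_card[symmetric] card_Diff_singleton)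
qed

text \<open>The term \<open>x \<otimes> y\<close> cancels, and a line with normal vector
  \<open>(b, a)\<close> remains. It is parametrised by whichever coordinate has its partner
  multiplied by a nonzero coefficient.\<close>

lemma card_product_derivative_fibre:
  assumes a: "a \<in> carrier R" and b: "b \<in> carrier R" and c: "c \<in> carrier R"
    and nz: "a \<noteq> \<zero> \<or> b \<noteq> \<zero>"
  shows "card {z \<in> carrier R \<times> carrier R. (fst z \<oplus> a) \<otimes> (snd z \<oplus> b) = c \<oplus> fst z \<otimes> snd z}
    = card (carrier R)"
proof -
  have eq: "(x \<oplus> a) \<otimes> (y \<oplus> b) = c \<oplus> x \<otimes> y \<longleftrightarrow> a \<otimes> y \<oplus> b \<otimes> x = c \<ominus> a \<otimes> b"
    if xy: "x \<in> carrier R" "y \<in> carrier R" for x y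
  proof -
    have "(x \<oplus> a) \<otimes> (y \<oplus> b) \<ominus> (c \<oplus> x \<otimes> y) = (a \<otimes> y \<oplus> b \<otimes> x) \<ominus> (c \<ominus> a \<otimes> b)"
      using xy a b c by algebra
    then show ?thesis
      using xy a b c r_right_minus_eq[of "(x \<oplus> a) \<otimes> (y \<oplus> b)" "c \<oplus> x \<otimes> y"]
        r_right_minus_eq[of "a \<otimes> y \<oplus> b \<otimes> x" "c \<ominus> a \<otimes> b"] by simp
  qed
  define d where "d = c \<ominus> a \<otimes> b"
  have d: "d \<in> carrier R" using a b c by (simp add: d_def)
  have solve: "u \<otimes> y \<oplus> v \<otimes> x = d \<longleftrightarrow> y = inv u \<otimes> (d \<ominus> v \<otimes> x)"
    if u: "u \<in> carrier R" "u \<noteq> \<zero>" and v: "v \<in> carrier R" and xy: "x \<in> carrier R" "y \<in> carrier R" for u v x y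
  proof -
    have U: "u \<in> Units R" using u by (simp add: field_Units)
    then have i: "inv u \<in> carrier R" "u \<otimes> inv u = \<one>" by auto
    show ?thesis
    proof
      assume "u \<otimes> y \<oplus> v \<otimes> x = d"
      moreover have "u \<otimes> y = (u \<otimes> y \<oplus> v \<otimes> x) \<ominus> v \<otimes> x"
        using u(1) v xy by algebra
      ultimately have "u \<otimes> y = d \<ominus> v \<otimes> x" by simp
      then have "inv u \<otimes> (d \<ominus> v \<otimes> x) = inv u \<otimes> (u \<otimes> y)" by simp
      also have "\<dots> = (u \<otimes> inv u) \<otimes> y"
        using u(1) i(1) xy by algebra
      finally show "y = inv u \<otimes> (d \<ominus> v \<otimes> x)"
        using i xy by simp
    next
      assume y: "y = inv u \<otimes> (d \<ominus> v \<otimes> x)"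
      have "u \<otimes> y = (u \<otimes> inv u) \<otimes> (d \<ominus> v \<otimes> x)"
        unfolding y using u(1) i(1) v xy(1) d by algebra
      then show "u \<otimes> y \<oplus> v \<otimes> x = d"
        using i v xy d u by (simp add: a_minus_def a_assoc l_neg)
    qed
  qed
  let ?S = "{z \<in> carrier R \<times> carrier R. (fst z \<oplus> a) \<otimes> (snd z \<oplus> b) = c \<oplus> fst z \<otimes> snd z}"
  show ?thesis
  proof (cases "a = \<zero>")
    case False
    then have i: "inv a \<in> carrier R" using a by (simp add: field_Units)
    have "bij_betw (\<lambda>x. (x, inv a \<otimes> (d \<ominus> b \<otimes> x))) (carrier R) ?S"
      using a b c d i False
      by (intro bij_betw_byWitness[where f' = fst]) (auto simp: eq solve simp flip: d_def)
    then show ?thesis by (rule bij_betw_same_card[symmetric])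
  next
    case True
    then have nz: "b \<noteq> \<zero>" using nz by simp
    then have i: "inv b \<in> carrier R" using b by (simp add: field_Units)
    \<comment> \<open>The same line with its summands exchanged, so that \<open>solve\<close>
      applies with \<open>b\<close> in the role of the invertible coefficient.\<close>
    have eq': "(x \<oplus> a) \<otimes> (y \<oplus> b) = c \<oplus> x \<otimes> y \<longleftrightarrow> b \<otimes> x \<oplus> a \<otimes> y = d"
      if "x \<in> carrier R" "y \<in> carrier R" for x y
      using eq[OF that] that a b by (simp add: d_def a_comm)
    have "bij_betw (\<lambda>y. (inv b \<otimes> (d \<ominus> a \<otimes> y), y)) (carrier R) ?S"
      using a b c d i nz
      by (intro bij_betw_byWitness[where f' = snd]) (auto simp: eq' solve)
    then show ?thesis by (rule bij_betw_same_card[symmetric])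
  qed
qed

end

section \<open>The two constructions\<close>

lemma (in abelian_group) add_monoid_exponent:
  "[p] \<cdot> z = \<zero> \<Longrightarrow> z [^]\<^bsub>add_monoid G\<^esub> (p::nat) = \<one>\<^bsub>add_monoid G\<^esub>"
  by (simp add: add_pow_def)

lemma DirProd_pow:
  "z [^]\<^bsub>G \<times>\<times> H\<^esub> (i::nat) = (fst z [^]\<^bsub>G\<^esub> i, snd z [^]\<^bsub>H\<^esub> i)"
  by (induction i) (simp_all add: mult_DirProd' prod_eq_iff)

lemma exists_bent_product:
  assumes p: "prime p" and k: "k > 0" and mk: "m \<le> k"
  shows "\<exists>F. bent p (2 * k) m F \<and>
    card (fibre p (2 * k) F (Fp_zero p m)) = (2 * p ^ k - 1) + (p ^ (k - m) - 1) * (p ^ k - 1) \<and>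
    (\<forall>\<beta>\<in>Fp_space p m - {Fp_zero p m}. card (fibre p (2 * k) F \<beta>) = p ^ (k - m) * (p ^ k - 1))"
proof -
  obtain L :: "((int list \<times> nat) multiset \<Rightarrow> int) ring" where L: "field L"
    and card: "card (carrier L) = p ^ k" and char: "\<And>z. z \<in> carrier L \<Longrightarrow> [p] \<cdot>\<^bsub>L\<^esub> z = \<zero>\<^bsub>L\<^esub>"
    using exists_finite_field[OF p k] by blast
  interpret L: field L by (rule L)
  have fin: "finite (carrier L)"
    using card prime_gt_0_nat[OF p] by (intro card_ge_0_finite) simp
  let ?H = "add_monoid L"
  have H: "comm_group ?H" by (rule L.a_comm_group)
  interpret H: comm_group ?H by (rule H)
  have G: "comm_group (?H \<times>\<times> ?H)"
  proof (rule group.group_comm_groupI)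
    show "Group.group (?H \<times>\<times> ?H)"
      by (intro DirProd_group) unfold_locales
  qed (auto simp: DirProd_def L.a_comm)
  have expH: "z [^]\<^bsub>?H\<^esub> p = \<one>\<^bsub>?H\<^esub>" if "z \<in> carrier ?H" for z
    using that by (intro L.add_monoid_exponent char) simp
  show ?thesis
  proof (rule perfect_nonlinear_imp_bent[OF p G H _ expH, where f = "\<lambda>z. fst z \<otimes>\<^bsub>L\<^esub> snd z"])
    show "z [^]\<^bsub>?H \<times>\<times> ?H\<^esub> p = \<one>\<^bsub>?H \<times>\<times> ?H\<^esub>" if "z \<in> carrier (?H \<times>\<times> ?H)" for z
      using that expH by (auto simp: DirProd_pow)
    show "card (carrier (?H \<times>\<times> ?H)) = p ^ (2 * k)"
      by (simp add: card_cartesian_product card mult_2 power_add)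
    show "card {z \<in> carrier (?H \<times>\<times> ?H). fst (z \<otimes>\<^bsub>?H \<times>\<times> ?H\<^esub> a) \<otimes>\<^bsub>L\<^esub> snd (z \<otimes>\<^bsub>?H \<times>\<times> ?H\<^esub> a)
        = b \<otimes>\<^bsub>?H\<^esub> (fst z \<otimes>\<^bsub>L\<^esub> snd z)} = p ^ (2 * k - k)"
      if a: "a \<in> carrier (?H \<times>\<times> ?H)" "a \<noteq> \<one>\<^bsub>?H \<times>\<times> ?H\<^esub>" and b: "b \<in> carrier ?H" for a b
      using L.card_product_derivative_fibre[of "fst a" "snd a" b] a b
      by (auto simp: mult_DirProd' card prod_eq_iff)
    show "card {z \<in> carrier (?H \<times>\<times> ?H). fst z \<otimes>\<^bsub>L\<^esub> snd z = \<one>\<^bsub>?H\<^esub>} = 2 * p ^ k - 1"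
      using L.card_product_fibre_zero[OF fin] by (simp add: card)
    show "card {z \<in> carrier (?H \<times>\<times> ?H). fst z \<otimes>\<^bsub>L\<^esub> snd z = c} = p ^ k - 1"
      if "c \<in> carrier ?H" "c \<noteq> \<one>\<^bsub>?H\<^esub>" for c
      using L.card_product_fibre[OF fin, of c] that by (simp add: card)
  qed (use mk card in auto)
qed

lemma exists_bent_norm:
  assumes p: "prime p" and k: "k > 0" and mk: "m \<le> k"
  shows "\<exists>F. bent p (2 * k) m F \<and>
    card (fibre p (2 * k) F (Fp_zero p m)) = 1 + (p ^ (k - m) - 1) * (p ^ k + 1) \<and>
    (\<forall>\<beta>\<in>Fp_space p m - {Fp_zero p m}. card (fibre p (2 * k) F \<beta>) = p ^ (k - m) * (p ^ k + 1))"
proof -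
  obtain L :: "((int list \<times> nat) multiset \<Rightarrow> int) ring" where L: "field L"
    and card: "card (carrier L) = p ^ (2 * k)" and char: "\<And>z. z \<in> carrier L \<Longrightarrow> [p] \<cdot>\<^bsub>L\<^esub> z = \<zero>\<^bsub>L\<^esub>"
    using exists_finite_field[OF p, of "2 * k"] k by auto
  interpret L: field L by (rule L)
  interpret L: quadratic_finite_field L p k "p ^ k"
    using p k char card by unfold_locales (auto simp: mult_2 power_add)
  \<comment> \<open>The target is \<open>K\<close> as a field in its own right: its additive group
    has order \<open>p ^ k\<close>, whereas that of \<open>L\<close> has order
    \<open>p ^ (2 * k)\<close>.\<close>
  let ?S = "L\<lparr>carrier := L.K\<rparr>"
  interpret S: field ?S
    using L.subfield_iff(2)[OF L.subfield_K] .
  have G: "comm_group (add_monoid L)" and H: "comm_group (add_monoid ?S)"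
    by (rule L.a_comm_group S.a_comm_group)+
  have charS: "[p] \<cdot>\<^bsub>?S\<^esub> z = \<zero>\<^bsub>?S\<^esub>" if "z \<in> L.K" for z
  proof -
    have "[i] \<cdot>\<^bsub>?S\<^esub> z = [i] \<cdot>\<^bsub>L\<^esub> z" for i :: nat
      by (simp add: add_pow_def nat_pow_def)
    then show ?thesis
      using char[OF L.K_carrier[OF that]] by simp
  qed
  show ?thesis
  proof (rule perfect_nonlinear_imp_bent[OF p G H, where f = "\<lambda>x. x [^]\<^bsub>L\<^esub> (p ^ k + 1)"])
    show "z [^]\<^bsub>add_monoid L\<^esub> p = \<one>\<^bsub>add_monoid L\<^esub>" if "z \<in> carrier (add_monoid L)" for z
      using that by (intro L.add_monoid_exponent char) simp
    show "z [^]\<^bsub>add_monoid ?S\<^esub> p = \<one>\<^bsub>add_monoid ?S\<^esub>" if "z \<in> carrier (add_monoid ?S)" for z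
      using that by (intro S.add_monoid_exponent charS) simp
    show "(\<lambda>x. x [^]\<^bsub>L\<^esub> (p ^ k + 1)) \<in> carrier (add_monoid L) \<rightarrow> carrier (add_monoid ?S)"
      using L.norm_in_K by (auto simp del: L.nat_pow_Suc)
    show "card {x \<in> carrier (add_monoid L). (x \<otimes>\<^bsub>add_monoid L\<^esub> a) [^]\<^bsub>L\<^esub> (p ^ k + 1)
        = b \<otimes>\<^bsub>add_monoid ?S\<^esub> x [^]\<^bsub>L\<^esub> (p ^ k + 1)} = p ^ (2 * k - k)"
      if "a \<in> carrier (add_monoid L)" "a \<noteq> \<one>\<^bsub>add_monoid L\<^esub>" "b \<in> carrier (add_monoid ?S)" for a b
      using L.card_norm_derivative_fibre[of a b] that by simp
    \<comment> \<open>Anisotropy of the norm: this is the summand 1 in the size of the zero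
      fibre.\<close>
    have "{x \<in> carrier L. x [^]\<^bsub>L\<^esub> (p ^ k + 1) = \<zero>\<^bsub>L\<^esub>} = {\<zero>\<^bsub>L\<^esub>}"
      using L.norm_eq_zero_iff by blast
    then show "card {x \<in> carrier (add_monoid L). x [^]\<^bsub>L\<^esub> (p ^ k + 1) = \<one>\<^bsub>add_monoid ?S\<^esub>} = 1"
      by simp
    show "card {x \<in> carrier (add_monoid L). x [^]\<^bsub>L\<^esub> (p ^ k + 1) = c} = p ^ k + 1"
      if "c \<in> carrier (add_monoid ?S)" "c \<noteq> \<one>\<^bsub>add_monoid ?S\<^esub>" for c
      using L.card_norm_fibre[of c] that by simp
  qed (use mk card L.card_K in auto)
qed

theorem theorem3p12:
  fixes p n m :: nat
  assumes "prime p" and "even n" and "n > 0" and "m > 0" and "real m \<le> real n / 2"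
  shows "(\<exists>F. bent p n m F \<and> almost_balanced_plus p n m F) \<and>
         (\<exists>F. bent p n m F \<and> almost_balanced_minus p n m F)"
proof -
  obtain k where n: "n = 2 * k"
    using assms(2) by (elim evenE)
  have k: "k > 0" and mk: "m \<le> k"
    using assms(3,5) by (auto simp: n)
  have p: "p > 0"
    using assms(1) by (rule prime_gt_0_nat)
  define r where "r = p ^ (k - m)"
  \<comment> \<open>Writing both powers as successors removes the truncated subtractions
    \<open>p ^ k - 1\<close> and \<open>r - 1\<close> from the fibre sizes before they are compared
    with real expressions.\<close>
  obtain Q' r' where Q': "p ^ k = Suc Q'" and r': "r = Suc r'"
    using p by (metis gr0_implies_Suc r_def zero_less_power)
  have Q: "real p ^ k = 1 + real Q'"
    using Q' by (metis of_nat_Suc of_nat_power)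
  have pn: "real p powr (real n - real m) = real r * real p ^ k"
  proof -
    have "real n - real m = real ((k - m) + k)"
      using mk by (simp add: n of_nat_diff)
    then show ?thesis
      using p by (simp only: powr_realpow of_nat_0_less_iff power_add r_def of_nat_power)
  qed
  have pk: "real p powr (real n / 2) = real p ^ k"
    using p by (simp add: n powr_realpow)
  have pr: "real p powr (real n / 2 - real m) = real r"
  proof -
    have "real n / 2 - real m = real (k - m)"
      using mk by (simp add: n of_nat_diff)
    then show ?thesis
      using p by (simp only: powr_realpow of_nat_0_less_iff r_def of_nat_power)
  qed
  obtain F where F: "bent p n m F"
    "card (fibre p n F (Fp_zero p m)) = (2 * p ^ k - 1) + (r - 1) * (p ^ k - 1)"
    "\<And>\<beta>. \<beta> \<in> Fp_space p m - {Fp_zero p m} \<Longrightarrow> card (fibre p n F \<beta>) = r * (p ^ k - 1)"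
    using exists_bent_product[OF assms(1) k mk] unfolding n r_def by blast
  \<comment> \<open>With \<open>q\<close> for \<open>p ^ k\<close>, the sizes are (2q - 1) + (r -
    1)(q - 1) = rq + q - r over the zero vector and r(q - 1) = rq - r elsewhere.\<close>
  have "almost_balanced_plus p n m F"
    unfolding almost_balanced_plus_def pn pk pr Q
    using F(2,3)
    by (intro bexI[OF _ Fp_zero_in[OF p]]) (auto simp: Q' r' algebra_simps)
  moreover obtain F' where F': "bent p n m F'"
    "card (fibre p n F' (Fp_zero p m)) = 1 + (r - 1) * (p ^ k + 1)"
    "\<And>\<beta>. \<beta> \<in> Fp_space p m - {Fp_zero p m} \<Longrightarrow> card (fibre p n F' \<beta>) = r * (p ^ k + 1)"
    using exists_bent_norm[OF assms(1) k mk] unfolding n r_def by blast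
  \<comment> \<open>Here 1 + (r - 1)(q + 1) = rq - q + r over the zero vector and r(q + 1) = rq + r
    elsewhere, again with \<open>q\<close> for \<open>p ^ k\<close>.\<close>
  have "almost_balanced_minus p n m F'"
    unfolding almost_balanced_minus_def pn pk pr Q
    using F'(2,3)
    by (intro bexI[OF _ Fp_zero_in[OF p]]) (auto simp: Q' r' algebra_simps)
  ultimately show ?thesis
    using F(1) F'(1) by blast
qed

end
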